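(* Let $X$ be an F-sequence space in which $(e_n)_{n\geq 0}$ is a basis. Let $w=(w_n)_{n\ge1}$ be a sequence of non-zero scalars and suppose that the weighted backward shift $B_w$ is an operator on $X$. Let $\mathcal{A}$ be a uniformly finitely invariant (u.f.i.) upper Furstenberg family. Consider the condition: (C) for any $p\geq 0$ and $\varepsilon>0$ there exists some $A\in\mathcal{A}$, $A\subset [p,\infty)$, such that (i) $\displaystyle\sum_{n\in A} \frac{1}{\prod_{\nu=1}^n w_\nu}e_{n}$ converges in $X$; (ii) for any $m\in A$, $\displaystyle\Big\|\sum _{n\in A,\, n>m} \frac{1}{\prod_{\nu=1}^{n-m+p} w_\nu}e_{n-m+p}\Big\| <\varepsilon$. (a) If (C) holds, then $B_w$ is $\mathcal{A}$-hypercyclic. (b) If $X$ is a Fréchet sequence space in which $(e_n)_{n\geq 0}$ is an unconditional basis, then the converse also holds, that is, if $B_w$ is $\mathcal{A}$-hypercyclic then (C) holds.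
   Context: Let $\mathbb{N}_0=\{0,1,2,\ldots\}$. For $A\subset\mathbb{N}_0$ and $n\geq 0$, $A-n=\{k-n : k\in A, k\geq n\}$. A Furstenberg family is a non-empty family $\mathcal{A}$ of subsets of $\mathbb{N}_0$ that is hereditary upward: $A\in\mathcal{A}$, $B\supset A$ imply $B\in\mathcal{A}$. It is proper if $\varnothing\notin\mathcal{A}$. A Furstenberg family $\mathcal{A}$ is called upper if it is proper and it can be written as $\mathcal{A} = \bigcup_{\delta\in D} \mathcal{A}_{\delta}$ with $\mathcal{A}_{\delta}=\bigcap_{\mu\in M} \mathcal{A}_{\delta,\mu}$ for some families $\mathcal{A}_{\delta,\mu}$ of subsets of $\mathbb{N}_0$ ($\delta\in D,\mu\in M$), where the index set $D$ is arbitrary but $M$ is countable, and such that: (1) each $\mathcal{A}_{\delta,\mu}$ is finitely hereditary upward, that is, for any $A\in \mathcal{A}_{\delta,\mu}$ there is a finite set $F\subset\mathbb{N}_0$ such that $B\supset A\cap F$ implies $B\in\mathcal{A}_{\delta,\mu}$; (2) $\mathcal{A}$ is uniformly left-invariant, that is, for any $A\in \mathcal{A}$ there is some $\delta\in D$ such that, for all $n\geq 0$, $A-n\in \mathcal{A}_\delta$. Such an upper Furstenberg family is called uniformly finitely invariant (u.f.i.) if, for any $A\in\mathcal{A}$, there is some $\delta\in D$ such that, for all $n\geq 0$, $A\setminus[0,n]\in\mathcal{A}_\delta$. A continuous map $T:X\to X$ is $\mathcal{A}$-hypercyclic if there exists $x\in X$ such that, for any non-empty open set $U$ in $X$, $\{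 n\geq 0 : T^nx\in U\}\in \mathcal{A}$. An F-norm on a vector space over $\mathbb{K}=\mathbb{R}$ or $\mathbb{C}$ is a function $\|\cdot\|\ge 0$ with $\|x+y\|\leq\|x\|+\|y\|$, $\|\lambda x\|\leq\|x\|$ for $|\lambda|\leq 1$, $\lim_{\lambda\to 0}\|\lambda x\|=0$, and $\|x\|=0$ only if $x=0$. An F-space is a metrizable topological vector space that is complete under some (equivalently any) F-norm defining its topology; $\|\cdot\|$ denotes a fixed F-norm defining the topology of $X$. An F-sequence space is an F-space that is a subspace of $\mathbb{K}^{\mathbb{N}_0}$ and such that each coordinate functional $x=(x_n)_{n\geq 0}\mapsto x_k$, $k\geq 0$, is continuous; a Fréchet sequence space is defined analogously, with a Fréchet space in place of an F-space. $e_n=(\delta_{n,k})_{k\geq 0}$ are the canonical unit sequences. The weighted backward shift is $B_w((x_n)_{n\geq 0})=(w_{n+1}x_{n+1})_{n\geq 0}$. An operator on $X$ is a continuous linear map $X\to X$. Sums over subsets of $\mathbb{N}_0$ are taken in increasing order of the index; the series in (ii) converges automatically once (i) holds, by continuity of $B_w$. *)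

theory Defs
  imports "HOL-Analysis.Analysis" "HOL-Library.Function_Algebras"
begin

text \<open>
  The scalar field is a type of sort \<open>{real_normed_field, euclidean_space}\<close>. Both \<^typ>\<open>real\<close> and
  \<^typ>\<open>complex\<close> are of this sort, and by the Gelfand-Mazur theorem there is no other such field up
  to isometric isomorphism.
  Sequences are functions on \<^typ>\<open>nat\<close>; addition and subtraction are pointwise.
\<close>

section \<open>Furstenberg families\<close>

definition furstenberg_family :: "nat set set \<Rightarrow> bool" where
  "furstenberg_family \<A> \<longleftrightarrow> \<A> \<noteq> {} \<and> (\<forall>A\<in>\<A>. \<forall>B. A \<subseteq> B \<longrightarrow> B \<in> \<A>)"

definition proper_family :: "nat set set \<Rightarrow> bool" where
  "proper_family \<A> \<longleftrightarrow> {} \<notin> \<A>"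

definition finitely_hereditary_upward :: "nat set set \<Rightarrow> bool" where
  "finitely_hereditary_upward \<B> \<longleftrightarrow>
     (\<forall>A\<in>\<B>. \<exists>F. finite F \<and> (\<forall>B. A \<inter> F \<subseteq> B \<longrightarrow> B \<in> \<B>))"

definition left_shift :: "nat set \<Rightarrow> nat \<Rightarrow> nat set" where
  "left_shift A n = {k - n |k. k \<in> A \<and> n \<le> k}"

text \<open>
  The representing family \<open>F\<close> and its index sets \<open>D\<close>, \<open>M\<close> (over arbitrary types) are arguments,
  because HOL cannot quantify existentially over the index types.
\<close>

definition upper_furstenberg_family ::
    "nat set set \<Rightarrow> 'd set \<Rightarrow> 'm set \<Rightarrow> ('d \<Rightarrow> 'm \<Rightarrow> nat set set) \<Rightarrow> bool" where
  "upper_furstenberg_family \<A> D M F \<longleftrightarrow>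
     furstenberg_family \<A> \<and> proper_family \<A> \<and>
     countable M \<and>
     \<A> = (\<Union>\<delta>\<in>D. \<Inter>\<mu>\<in>M. F \<delta> \<mu>) \<and>
     (\<forall>\<delta>\<in>D. \<forall>\<mu>\<in>M. finitely_hereditary_upward (F \<delta> \<mu>)) \<and>
     (\<forall>A\<in>\<A>. \<exists>\<delta>\<in>D. \<forall>n. left_shift A n \<in> (\<Inter>\<mu>\<in>M. F \<delta> \<mu>))"

definition ufi_upper_furstenberg_family ::
    "nat set set \<Rightarrow> 'd set \<Rightarrow> 'm set \<Rightarrow> ('d \<Rightarrow> 'm \<Rightarrow> nat set set) \<Rightarrow> bool" where
  "ufi_upper_furstenberg_family \<A> D M F \<longleftrightarrow>
     upper_furstenberg_family \<A> D M F \<and>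
     (\<forall>A\<in>\<A>. \<exists>\<delta>\<in>D. \<forall>n. A - {0..n} \<in> (\<Inter>\<mu>\<in>M. F \<delta> \<mu>))"

definition family_hypercyclic :: "nat set set \<Rightarrow> 'a topology \<Rightarrow> ('a \<Rightarrow> 'a) \<Rightarrow> bool" where
  "family_hypercyclic \<A> \<tau> T \<longleftrightarrow>
     continuous_map \<tau> \<tau> T \<and>
     (\<exists>x\<in>topspace \<tau>. \<forall>U. openin \<tau> U \<and> U \<noteq> {} \<longrightarrow> {n. (T ^^ n) x \<in> U} \<in> \<A>)"

section \<open>F-sequence spaces\<close>

definition seq_scale :: "'k::field \<Rightarrow> (nat \<Rightarrow> 'k) \<Rightarrow> (nat \<Rightarrow> 'k)" where
  "seq_scale c x = (\<lambda>n. c * x n)"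

interpretation seq: vector_space seq_scale
  by unfold_locales (auto simp: seq_scale_def fun_eq_iff algebra_simps)

definition F_norm_on ::
    "(nat \<Rightarrow> 'k::{real_normed_field,euclidean_space}) set \<Rightarrow> ((nat \<Rightarrow> 'k) \<Rightarrow> real) \<Rightarrow> bool" where
  "F_norm_on X nrm \<longleftrightarrow>
     (\<forall>x\<in>X. 0 \<le> nrm x) \<and>
     (\<forall>x\<in>X. \<forall>y\<in>X. nrm (x + y) \<le> nrm x + nrm y) \<and>
     (\<forall>x\<in>X. \<forall>c. norm c \<le> 1 \<longrightarrow> nrm (seq_scale c x) \<le> nrm x) \<and>
     (\<forall>x\<in>X. ((\<lambda>c. nrm (seq_scale c x)) \<longlongrightarrow> 0) (at 0)) \<and>
     (\<forall>x\<in>X. nrm x = 0 \<longrightarrow> x = 0)"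

text \<open>The value 0 off \<open>X\<close> is needed because the locale \<^locale>\<open>Metric_space\<close> requires
  nonnegativity and symmetry of the distance on the whole type.\<close>

definition F_dist :: "(nat \<Rightarrow> 'k::ab_group_add) set \<Rightarrow> ((nat \<Rightarrow> 'k) \<Rightarrow> real) \<Rightarrow>
    (nat \<Rightarrow> 'k) \<Rightarrow> (nat \<Rightarrow> 'k) \<Rightarrow> real" where
  "F_dist X nrm x y = (if x \<in> X \<and> y \<in> X then nrm (x - y) else 0)"

definition F_topology :: "(nat \<Rightarrow> 'k::ab_group_add) set \<Rightarrow> ((nat \<Rightarrow> 'k) \<Rightarrow> real) \<Rightarrow>
    (nat \<Rightarrow> 'k) topology" where
  "F_topology X nrm = Metric_space.mtopology X (F_dist X nrm)"

definition F_sequence_space ::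
    "(nat \<Rightarrow> 'k::{real_normed_field,euclidean_space}) set \<Rightarrow> ((nat \<Rightarrow> 'k) \<Rightarrow> real) \<Rightarrow> bool" where
  "F_sequence_space X nrm \<longleftrightarrow>
     seq.subspace X \<and> F_norm_on X nrm \<and>
     Metric_space.mcomplete X (F_dist X nrm) \<and>
     (\<forall>k. continuous_map (F_topology X nrm) euclidean (\<lambda>x. x k))"

lemma Metric_space_F_dist:
  assumes X: "seq.subspace X" and nrm: "F_norm_on X nrm"
  shows "Metric_space X (F_dist X nrm)"
proof
  have diff: "x - y \<in> X" if "x \<in> X" "y \<in> X" for x y
    using X that by (rule seq.subspace_diff)
  have nonneg: "0 \<le> nrm x" if "x \<in> X" for x
    using nrm that unfolding F_norm_on_def by meson
  have tri: "nrm (x + y) \<le> nrm x + nrm y" if "x \<in> X" "y \<in> X" for x y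
    using nrm that unfolding F_norm_on_def by meson
  have scale: "nrm (seq_scale c x) \<le> nrm x" if "x \<in> X" "norm c \<le> 1" for c x
    using nrm that unfolding F_norm_on_def by meson
  have definite: "x = 0" if "x \<in> X" "nrm x = 0" for x
    using nrm that unfolding F_norm_on_def by meson
  have zero: "nrm 0 = 0"
  proof -
    have "0 \<in> X" using X by (rule seq.subspace_0)
    then have "((\<lambda>c::'a. nrm (seq_scale c 0)) \<longlongrightarrow> 0) (at 0)"
      using nrm unfolding F_norm_on_def by meson
    then show ?thesis by (simp only: seq.scale_zero_right tendsto_const_iff at_neq_bot if_False
        trivial_limit_at not_False_eq_True)
  qed
  have le: "nrm (x - y) \<le> nrm (y - x)" if "x \<in> X" "y \<in> X" for x y
  proof -
    have "seq_scale (-1) (y - x) = x - y"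
      by (simp add: seq_scale_def fun_eq_iff)
    moreover have "norm (-1::'a) \<le> 1" by simp
    ultimately show ?thesis
      using scale[OF diff[OF that(2,1)], of "-1"] by (simp only: simp_thms)
  qed
  show "0 \<le> F_dist X nrm x y" for x y
    using nonneg[OF diff] by (simp add: F_dist_def)
  show "F_dist X nrm x y = F_dist X nrm y x" for x y
    using le[of x y] le[of y x] by (auto simp: F_dist_def)
  show "F_dist X nrm x y = 0 \<longleftrightarrow> x = y" if "x \<in> X" "y \<in> X" for x y
  proof
    assume "F_dist X nrm x y = 0"
    then have "x - y = 0"
      using that diff definite by (simp only: F_dist_def if_True simp_thms)
    then show "x = y" by (simp only: right_minus_eq)
  next
    assume "x = y"
    then show "F_dist X nrm x y = 0"
      by (simp only: F_dist_def diff_self zero if_cancel)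
  qed
  show "F_dist X nrm x z \<le> F_dist X nrm x y + F_dist X nrm y z"
    if "x \<in> X" "y \<in> X" "z \<in> X" for x y z
  proof -
    have "(x - y) + (y - z) = x - z" by simp
    then show ?thesis
      using tri[OF diff[of x y] diff[of y z]] that by (simp only: F_dist_def if_True simp_thms)
  qed
qed

definition seq_convex :: "(nat \<Rightarrow> 'k::real_normed_field) set \<Rightarrow> bool" where
  "seq_convex C \<longleftrightarrow>
     (\<forall>x\<in>C. \<forall>y\<in>C. \<forall>t\<in>{0..1}.
        seq_scale (of_real (1 - t)) x + seq_scale (of_real t) y \<in> C)"

text \<open>A Frechet space is a locally convex F-space.\<close>

definition Frechet_sequence_space ::
    "(nat \<Rightarrow> 'k::{real_normed_field,euclidean_space}) set \<Rightarrow> ((nat \<Rightarrow> 'k) \<Rightarrow> real) \<Rightarrow> bool" where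
  "Frechet_sequence_space X nrm \<longleftrightarrow>
     F_sequence_space X nrm \<and>
     (\<forall>U. openin (F_topology X nrm) U \<and> 0 \<in> U \<longrightarrow>
        (\<exists>C V. seq_convex C \<and> openin (F_topology X nrm) V \<and> 0 \<in> V \<and> V \<subseteq> C \<and> C \<subseteq> U))"

text \<open>Sum of \<open>f n\<close> over \<open>n \<in> A\<close> in increasing order; finite \<open>A\<close> is allowed.\<close>

definition series_sums ::
    "(nat \<Rightarrow> 'k::ab_group_add) set \<Rightarrow> ((nat \<Rightarrow> 'k) \<Rightarrow> real) \<Rightarrow>
     nat set \<Rightarrow> (nat \<Rightarrow> (nat \<Rightarrow> 'k)) \<Rightarrow> (nat \<Rightarrow> 'k) \<Rightarrow> bool" where
  "series_sums X nrm A f s \<longleftrightarrow>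
     limitin (F_topology X nrm) (\<lambda>N. \<Sum>n\<in>A \<inter> {..<N}. f n) s sequentially"

definition basis_of ::
    "(nat \<Rightarrow> 'k::field) set \<Rightarrow> ((nat \<Rightarrow> 'k) \<Rightarrow> real) \<Rightarrow> (nat \<Rightarrow> (nat \<Rightarrow> 'k)) \<Rightarrow> bool" where
  "basis_of X nrm b \<longleftrightarrow>
     (\<forall>n. b n \<in> X) \<and>
     (\<forall>x\<in>X. \<exists>!a. series_sums X nrm UNIV (\<lambda>n. seq_scale (a n) (b n)) x)"

definition unconditional_basis_of ::
    "(nat \<Rightarrow> 'k::field) set \<Rightarrow> ((nat \<Rightarrow> 'k) \<Rightarrow> real) \<Rightarrow> (nat \<Rightarrow> (nat \<Rightarrow> 'k)) \<Rightarrow> bool" where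
  "unconditional_basis_of X nrm b \<longleftrightarrow>
     basis_of X nrm b \<and>
     (\<forall>x\<in>X. \<forall>a. series_sums X nrm UNIV (\<lambda>n. seq_scale (a n) (b n)) x \<longrightarrow>
        (\<forall>\<pi>. bij \<pi> \<longrightarrow> series_sums X nrm UNIV (\<lambda>n. seq_scale (a (\<pi> n)) (b (\<pi> n))) x))"

definition unit_seq :: "nat \<Rightarrow> (nat \<Rightarrow> 'k::zero_neq_one)" where
  "unit_seq n = (\<lambda>k. if k = n then 1 else 0)"

definition operator_on ::
    "(nat \<Rightarrow> 'k::field) set \<Rightarrow> ((nat \<Rightarrow> 'k) \<Rightarrow> real) \<Rightarrow> ((nat \<Rightarrow> 'k) \<Rightarrow> (nat \<Rightarrow> 'k)) \<Rightarrow> bool" where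
  "operator_on X nrm T \<longleftrightarrow>
     T \<in> X \<rightarrow> X \<and>
     (\<forall>x\<in>X. \<forall>y\<in>X. T (x + y) = T x + T y) \<and>
     (\<forall>c. \<forall>x\<in>X. T (seq_scale c x) = seq_scale c (T x)) \<and>
     continuous_map (F_topology X nrm) (F_topology X nrm) T"

section \<open>Weighted backward shifts\<close>

text \<open>Weights are indexed from 1; the value \<open>w 0\<close> is never used.\<close>

definition weighted_backward_shift ::
    "(nat \<Rightarrow> 'k::field) \<Rightarrow> (nat \<Rightarrow> 'k) \<Rightarrow> (nat \<Rightarrow> 'k)" where
  "weighted_backward_shift w x = (\<lambda>n. w (n + 1) * x (n + 1))"

text \<open>Convergence of the second series is part of the condition; it follows from convergence of
  the first one if the shift is continuous.\<close>

definition shift_condition ::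
    "(nat \<Rightarrow> 'k::field) set \<Rightarrow> ((nat \<Rightarrow> 'k) \<Rightarrow> real) \<Rightarrow> (nat \<Rightarrow> 'k) \<Rightarrow> nat set set \<Rightarrow> bool" where
  "shift_condition X nrm w \<A> \<longleftrightarrow>
     (\<forall>p::nat. \<forall>\<epsilon>::real. \<epsilon> > 0 \<longrightarrow>
       (\<exists>A\<in>\<A>. A \<subseteq> {p..} \<and>
         (\<exists>s. series_sums X nrm A
                (\<lambda>n. seq_scale (1 / (\<Prod>\<nu>=1..n. w \<nu>)) (unit_seq n)) s) \<and>
         (\<forall>m\<in>A. \<exists>s. series_sums X nrm {n\<in>A. n > m}
                (\<lambda>n. seq_scale (1 / (\<Prod>\<nu>=1..n - m + p. w \<nu>)) (unit_seq (n - m + p))) s \<and>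
              nrm s < \<epsilon>)))"

end

theory Submission imports Defs begin

text \<open>
  Put \<open>f\<^sub>n = e\<^sub>n / (w\<^sub>1 \<cdots> w\<^sub>n)\<close>, so that the shift \<open>T = B\<^sub>w\<close> maps \<open>f\<^sub>n\<^sub>+\<^sub>1\<close> to \<open>f\<^sub>n\<close> and \<open>f\<^sub>0\<close> to \<open>0\<close>. The
  condition asks for sets \<open>A \<in> \<A>\<close> such that the sum of the \<open>f\<^sub>n\<close> over \<open>n \<in> A\<close> exists and such that
  the orbit of this sum is close to \<open>f\<^sub>p\<close>, apart from the terms with \<open>n < m\<close>, whenever it has been
  shifted by \<open>m - p\<close> with \<open>m \<in> A\<close>. Since \<open>(e\<^sub>n)\<close> is a basis and coordinates are continuous, a series
  in the unit sequences converges exactly if the sequence of its coefficients belongs to \<open>X\<close>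
  (\<open>series_sums_unit_iff\<close>), so all series become explicit sequences.

  Sufficiency is a category argument. Given a target \<open>y\<close> supported on \<open>{0..p}\<close>, there is a
  polynomial \<open>Q\<close> in \<open>T\<close> with \<open>Q f\<^sub>p = y\<close>. If \<open>\<epsilon>\<close> is small, the remainders in the condition force the
  gaps of \<open>A\<close> to exceed \<open>p\<close>, so no terms with \<open>m - p \<le> n < m\<close> interfere, and the orbit of
  \<open>z + Q (\<Sum>n\<in>A, n \<ge> N. f\<^sub>n)\<close> is close to \<open>y\<close> at all late times \<open>m - p\<close>, \<open>m \<in> A\<close>
  (\<open>shift_poly_orbit\<close>). Such vectors exist near every point, and the uniformity in the definition of
  a u.f.i. upper family provides one \<open>\<delta>\<close> for all of them. This is the hypothesis of the Baire
  argument \<open>family_hypercyclic_by_category\<close>.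

  For necessity, let \<open>A\<close> be the set of times \<open>m \<ge> p\<close> at which the orbit of an \<open>\<A>\<close>-hypercyclic vector
  is close to \<open>f\<^sub>p\<close>. The coefficient of the vector at \<open>f\<^sub>m\<^sub>+\<^sub>p\<close> is then close to \<open>1\<close>, and the series in
  the condition result from vectors of the orbit by restricting and rescaling coordinates with
  bounded multipliers. That such multipliers act on \<open>X\<close>, equicontinuously, is where the
  unconditional basis and local convexity enter: unconditional convergence makes finite sections
  far out small (\<open>finite_tails_small\<close>), Baire's theorem makes the finite sections equicontinuous
  (\<open>finite_sections_equicontinuous\<close>), and convexity passes from subsets to multipliers
  (\<open>convex_multiplier\<close>).
\<close>

section \<open>Sequences and coordinate projections\<close>

definition proj :: "nat set \<Rightarrow> (nat \<Rightarrow> 'k::zero) \<Rightarrow> nat \<Rightarrow> 'k" where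
  "proj S x = (\<lambda>k. if k \<in> S then x k else 0)"

lemma proj_apply: "proj S x k = (if k \<in> S then x k else 0)"
  by (simp add: proj_def)

lemma seq_scale_apply: "seq_scale c x k = c * x k"
  by (simp add: seq_scale_def)

lemma unit_seq_apply: "unit_seq n k = (if k = n then 1 else 0)"
  by (simp add: unit_seq_def)

lemma sum_fun_apply: "(\<Sum>i\<in>A. f i) k = (\<Sum>i\<in>A. f i k)"
  by (induction A rule: infinite_finite_induct) (auto simp: plus_fun_apply zero_fun_apply)

lemmas pointwise = fun_eq_iff plus_fun_apply minus_apply zero_fun_apply sum_fun_apply
  seq_scale_apply unit_seq_apply proj_apply

text \<open>
  Elements of \<open>X\<close> are treated as vectors; equations between them are reduced to coordinates only
  on request, through \<open>pointwise\<close>. Used by default, the evaluation rules would rewrite vectors that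
  occur as eta-expanded arguments of the F-norm.
\<close>

declare plus_fun_apply [simp del] minus_apply [simp del] zero_fun_apply [simp del]

lemma sum_unit_seq:
  fixes c :: "nat \<Rightarrow> 'k::field"
  assumes "finite A"
  shows "(\<Sum>n\<in>A. seq_scale (c n) (unit_seq n)) = proj A c"
proof
  fix k
  have "(\<Sum>n\<in>A. c n * (if k = n then 1 else 0)) = (\<Sum>n\<in>A. if k = n then c n else 0)"
    by (rule sum.cong) auto
  also have "\<dots> = proj A c k" using assms by (simp add: proj_apply)
  finally show "(\<Sum>n\<in>A. seq_scale (c n) (unit_seq n)) k = proj A c k" by (simp add: pointwise)
qed

section \<open>F-norms\<close>

locale F_seq_space =
  fixes X :: "(nat \<Rightarrow> 'k::{real_normed_field,euclidean_space}) set"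
    and nrm :: "(nat \<Rightarrow> 'k) \<Rightarrow> real"
  assumes F_space: "F_sequence_space X nrm"
begin

lemma subspace: "seq.subspace X" and F_norm: "F_norm_on X nrm"
  using F_space by (auto simp: F_sequence_space_def)

sublocale ms: Metric_space X "F_dist X nrm"
  by (rule Metric_space_F_dist[OF subspace F_norm])

lemma zero_in: "0 \<in> X"
  and add_in: "x \<in> X \<Longrightarrow> y \<in> X \<Longrightarrow> x + y \<in> X"
  and diff_in: "x \<in> X \<Longrightarrow> y \<in> X \<Longrightarrow> x - y \<in> X"
  and scale_in: "x \<in> X \<Longrightarrow> seq_scale c x \<in> X"
  and sum_in: "(\<And>i. i \<in> A \<Longrightarrow> f i \<in> X) \<Longrightarrow> sum f A \<in> X"
  using subspace by (auto intro: seq.subspace_0 seq.subspace_add seq.subspace_diff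
      seq.subspace_scale seq.subspace_sum)

lemma nrm_nonneg: "x \<in> X \<Longrightarrow> 0 \<le> nrm x"
  and nrm_triangle: "x \<in> X \<Longrightarrow> y \<in> X \<Longrightarrow> nrm (x + y) \<le> nrm x + nrm y"
  and nrm_scale_le: "x \<in> X \<Longrightarrow> norm c \<le> 1 \<Longrightarrow> nrm (seq_scale c x) \<le> nrm x"
  and nrm_scale_lim: "x \<in> X \<Longrightarrow> ((\<lambda>c. nrm (seq_scale c x)) \<longlongrightarrow> 0) (at 0)"
  using F_norm by (auto simp: F_norm_on_def)

lemma nrm_zero: "nrm 0 = 0"
  using ms.mdist_zero[OF zero_in] zero_in by (simp add: F_dist_def)

lemma nrm_diff_commute: "x \<in> X \<Longrightarrow> y \<in> X \<Longrightarrow> nrm (x - y) = nrm (y - x)"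
  using ms.commute[of x y] by (simp add: F_dist_def)

lemma nrm_diff_triangle: "x \<in> X \<Longrightarrow> y \<in> X \<Longrightarrow> z \<in> X \<Longrightarrow> nrm (x - z) \<le> nrm (x - y) + nrm (y - z)"
  using ms.triangle[of x y z] by (simp add: F_dist_def)

lemma nrm_diff_le:
  assumes "x \<in> X" "y \<in> X" shows "nrm (x - y) \<le> nrm x + nrm y"
proof -
  have "nrm (x + (0 - y)) \<le> nrm x + nrm (0 - y)"
    using assms by (intro nrm_triangle diff_in zero_in)
  moreover have "nrm (0 - y) = nrm (y - 0)" using assms by (intro nrm_diff_commute zero_in)
  moreover have "x + (0 - y) = x - y" "y - 0 = y" by simp_all
  ultimately show ?thesis by (simp only:)
qed

lemma nrm_sum_le: "(\<And>i. i \<in> A \<Longrightarrow> f i \<in> X) \<Longrightarrow> nrm (sum f A) \<le> (\<Sum>i\<in>A. nrm (f i))"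
proof (induction A rule: infinite_finite_induct)
  case (insert a A)
  have "nrm (f a + sum f A) \<le> nrm (f a) + nrm (sum f A)"
    using insert by (intro nrm_triangle sum_in) auto
  also have "\<dots> \<le> nrm (f a) + (\<Sum>i\<in>A. nrm (f i))" using insert by auto
  finally show ?case unfolding sum.insert[OF insert(1,2)] .
qed (auto simp: nrm_zero)

lemma nrm_of_nat_scale_le:
  assumes "x \<in> X" shows "nrm (seq_scale (of_nat k) x) \<le> of_nat k * nrm x"
proof -
  have "seq_scale (of_nat k) x = (\<Sum>i<k. x)" by (simp add: pointwise)
  then show ?thesis using nrm_sum_le[of "{..<k}" "\<lambda>_. x"] assms by simp
qed

lemma nrm_scale_small:
  assumes "x \<in> X" "0 < e"
  obtains r where "0 < r" "\<And>c. norm c < r \<Longrightarrow> nrm (seq_scale c x) < e"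
proof -
  have "\<forall>\<^sub>F c in at 0. nrm (seq_scale c x) < e"
    using nrm_scale_lim[OF assms(1)] assms(2) by (rule order_tendstoD)
  then obtain r where r: "0 < r" "\<And>c. c \<noteq> 0 \<Longrightarrow> norm c < r \<Longrightarrow> nrm (seq_scale c x) < e"
    by (auto simp: eventually_at dist_norm)
  have "nrm (seq_scale c x) < e" if "norm c < r" for c
  proof (cases "c = 0")
    case True
    then have "seq_scale c x = 0" by (simp add: pointwise)
    then show ?thesis using assms nrm_zero by (simp only:)
  qed (use r that in auto)
  then show ?thesis using r that by blast
qed

lemma openin_iff:
  "openin (F_topology X nrm) U \<longleftrightarrow>
     U \<subseteq> X \<and> (\<forall>x\<in>U. \<exists>r>0. \<forall>y\<in>X. nrm (y - x) < r \<longrightarrow> y \<in> U)"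
proof -
  have "ms.mball x r = {y\<in>X. nrm (y - x) < r}" if "x \<in> X" for x r
    using that nrm_diff_commute[of x] by (auto simp: ms.mball_def F_dist_def)
  then have "(\<exists>r>0. ms.mball x r \<subseteq> U) \<longleftrightarrow> (\<exists>r>0. \<forall>y\<in>X. nrm (y - x) < r \<longrightarrow> y \<in> U)"
    if "x \<in> X" for x
    using that by (simp only: subset_iff mem_Collect_eq) blast
  then show ?thesis
    unfolding F_topology_def ms.openin_mtopology by blast
qed

lemma openin_ball:
  assumes "a \<in> X" shows "openin (F_topology X nrm) {x\<in>X. nrm (x - a) < r}"
proof -
  have "{x\<in>X. nrm (x - a) < r} = ms.mball a r"
    using assms nrm_diff_commute[of a] by (auto simp: ms.mball_def F_dist_def)
  then show ?thesis by (simp add: F_topology_def)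
qed

lemma topspace_F: "topspace (F_topology X nrm) = X"
  by (simp add: F_topology_def)

lemma limitin_iff:
  "limitin (F_topology X nrm) f s sequentially \<longleftrightarrow>
     s \<in> X \<and> (\<forall>e>0. \<exists>N. \<forall>n\<ge>N. f n \<in> X \<and> nrm (f n - s) < e)"
proof -
  have eq: "f n \<in> X \<and> F_dist X nrm (f n) s < e \<longleftrightarrow> f n \<in> X \<and> nrm (f n - s) < e"
    if "s \<in> X" for n e
    using that by (auto simp: F_dist_def)
  show ?thesis
    unfolding F_topology_def ms.limit_metric_sequentially
    by (rule conj_cong[OF refl]) (simp only: eq)
qed

lemma complete:
  assumes "\<And>n. f n \<in> X" "\<And>e. 0 < e \<Longrightarrow> \<exists>N. \<forall>n\<ge>N. nrm (f n - f N) < e"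
  obtains s where "limitin (F_topology X nrm) f s sequentially"
proof -
  have "ms.MCauchy f"
    unfolding ms.MCauchy_def
  proof (intro conjI allI impI)
    fix e :: real assume "e > 0"
    then obtain N where N: "\<And>n. n \<ge> N \<Longrightarrow> nrm (f n - f N) < e/2"
      using assms(2)[of "e/2"] by auto
    have "nrm (f n - f n') < e" if "N \<le> n" "N \<le> n'" for n n'
    proof -
      have "nrm ((f n - f N) - (f n' - f N)) \<le> nrm (f n - f N) + nrm (f n' - f N)"
        by (intro nrm_diff_le diff_in assms(1))
      then show ?thesis using N[of n] N[of n'] that by simp
    qed
    then show "\<exists>N. \<forall>n n'. N \<le> n \<longrightarrow> N \<le> n' \<longrightarrow> F_dist X nrm (f n) (f n') < e"
      using assms(1) by (auto simp: F_dist_def)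
  qed (use assms(1) in auto)
  then show ?thesis
    using F_space that by (auto simp: F_sequence_space_def F_topology_def ms.mcomplete_def)
qed

lemma continuous_coord: "continuous_map (F_topology X nrm) euclidean (\<lambda>x. x k)"
  using F_space by (auto simp: F_sequence_space_def)

lemma limit_coord:
  assumes "limitin (F_topology X nrm) f s sequentially"
  shows "(\<lambda>n. f n k) \<longlonglongrightarrow> s k"
  using continuous_map_limit[OF continuous_coord assms, of k] by (simp add: o_def)

lemma coord_small:
  assumes "0 < e"
  obtains r where "0 < r" "\<And>x. x \<in> X \<Longrightarrow> nrm x < r \<Longrightarrow> norm (x k) < e"
proof -
  have "openin (F_topology X nrm) {x \<in> topspace (F_topology X nrm). x k \<in> ball 0 e}"
    by (rule openin_continuous_map_preimage[OF continuous_coord]) simp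
  moreover have "0 \<in> {x \<in> X. x k \<in> ball 0 e}"
    using assms zero_in by (simp add: zero_fun_apply)
  ultimately have "\<exists>r>0. \<forall>y\<in>X. nrm (y - 0) < r \<longrightarrow> y \<in> {x \<in> X. x k \<in> ball 0 e}"
    unfolding openin_iff topspace_F by blast
  then show ?thesis using that by auto
qed

lemma nrm_limit_le:
  assumes "limitin (F_topology X nrm) f s sequentially" "\<And>n. nrm (f n) \<le> e"
  shows "nrm s \<le> e"
proof (rule field_le_epsilon)
  fix d :: real assume "0 < d"
  then obtain n where n: "s \<in> X" "f n \<in> X" "nrm (f n - s) < d"
    using assms(1) by (auto simp: limitin_iff)
  have "nrm (f n - (f n - s)) \<le> nrm (f n) + nrm (f n - s)"
    using n by (intro nrm_diff_le diff_in) auto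
  then show "nrm s \<le> e + d" using n assms(2)[of n] by simp
qed

end

section \<open>Unit sequences as a basis\<close>

locale F_seq_space_basis = F_seq_space +
  assumes basis: "basis_of X nrm unit_seq"
begin

lemma unit_in: "unit_seq n \<in> X"
  using basis by (auto simp: basis_of_def)

lemma proj_finite_in: "finite A \<Longrightarrow> proj A c \<in> X"
  by (subst sum_unit_seq[symmetric]) (auto intro!: sum_in scale_in unit_in)

lemma limit_of_sections:
  assumes "limitin (F_topology X nrm) (\<lambda>N. proj {..<N} c) s sequentially"
  shows "s = c"
proof
  fix k
  have "(\<lambda>N. proj {..<N} c k) \<longlonglongrightarrow> c k"
    by (rule tendsto_eventually, rule eventually_mono[OF eventually_gt_at_top[of k]])
      (simp add: proj_apply)
  with limit_coord[OF assms, of k] show "s k = c k" by (rule LIMSEQ_unique)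
qed

text \<open>
  The coordinate functionals are continuous, so the coefficients of the basis expansion of \<open>x\<close> can
  only be the coordinates of \<open>x\<close>.
\<close>

lemma sections_converge:
  assumes "x \<in> X"
  shows "limitin (F_topology X nrm) (\<lambda>N. proj {..<N} x) x sequentially"
proof -
  obtain a where "series_sums X nrm UNIV (\<lambda>n. seq_scale (a n) (unit_seq n)) x"
    using basis assms unfolding basis_of_def by blast
  then have a: "limitin (F_topology X nrm) (\<lambda>N. proj {..<N} a) x sequentially"
    by (simp add: series_sums_def sum_unit_seq)
  then show ?thesis using limit_of_sections by blast
qed

lemma section_near:
  assumes "x \<in> X" "0 < e"
  obtains N where "\<And>n. n \<ge> N \<Longrightarrow> nrm (proj {..<n} x - x) < e"
proof -
  have "\<exists>N. \<forall>n\<ge>N. proj {..<n} x \<in> X \<and> nrm (proj {..<n} x - x) < e"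
    using sections_converge[OF assms(1)] assms(2) by (simp only: limitin_iff)
  then show ?thesis using that by auto
qed

lemma limit_sections_iff:
  "limitin (F_topology X nrm) (\<lambda>N. proj {..<N} c) s sequentially \<longleftrightarrow> s \<in> X \<and> s = c"
  by (metis limit_of_sections sections_converge limitin_topspace topspace_F)

text \<open>
  A series in the unit sequences can only converge to the sequence of its coefficients. So
  convergence means that one explicit sequence belongs to \<open>X\<close>. Here and in the shifted version
  below, this turns the series in the shift condition into coordinate statements.
\<close>

lemma series_sums_unit_iff:
  "series_sums X nrm A (\<lambda>n. seq_scale (c n) (unit_seq n)) s \<longleftrightarrow> s \<in> X \<and> s = proj A c"
proof -
  have "(\<Sum>n\<in>A \<inter> {..<N}. seq_scale (c n) (unit_seq n)) = proj {..<N} (proj A c)" for N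
    by (subst sum_unit_seq) (auto simp: pointwise)
  then show ?thesis
    unfolding series_sums_def by (simp add: limit_sections_iff)
qed

lemma series_sums_shifted_unit_iff:
  "series_sums X nrm {n\<in>A. n > m} (\<lambda>n. seq_scale (c (n - m + p)) (unit_seq (n - m + p))) s \<longleftrightarrow>
     s \<in> X \<and> s = proj {k. k > p \<and> k + m - p \<in> A} c"
    (is "series_sums X nrm ?A ?f s \<longleftrightarrow> s \<in> X \<and> s = proj ?K c")
proof -
  \<comment> \<open>Along \<open>N + m\<close> the subtraction \<open>n - m\<close> is compatible with the truncation, so the partial sums are
    sections of the limit.\<close>
  have eq: "(\<Sum>n\<in>?A \<inter> {..<N+m}. ?f n) = proj {..<N+p} (proj ?K c)" for N
  proof -
    have "(\<Sum>n\<in>?A \<inter> {..<N+m}. ?f n) = (\<Sum>k\<in>?K \<inter> {..<N+p}. seq_scale (c k) (unit_seq k))"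
      by (rule sum.reindex_bij_witness[where i = "\<lambda>k. k + m - p" and j = "\<lambda>n. n - m + p"]) auto
    also have "\<dots> = proj {..<N+p} (proj ?K c)" by (subst sum_unit_seq) (auto simp: pointwise)
    finally show ?thesis .
  qed
  have shift: "limitin Y (\<lambda>N. g (N + j)) s sequentially \<longleftrightarrow> limitin Y g s sequentially"
    for Y :: "(nat \<Rightarrow> 'a) topology" and g j
    by (rule iffI, erule limitin_sequentially_offset_rev, erule limitin_sequentially_offset)
  have "series_sums X nrm ?A ?f s \<longleftrightarrow>
      limitin (F_topology X nrm) (\<lambda>N. \<Sum>n\<in>?A \<inter> {..<N+m}. ?f n) s sequentially"
    unfolding series_sums_def by (rule shift[symmetric])
  also have "\<dots> \<longleftrightarrow> limitin (F_topology X nrm) (\<lambda>N. proj {..<N+p} (proj ?K c)) s sequentially"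
    by (simp only: eq)
  also have "\<dots> \<longleftrightarrow> limitin (F_topology X nrm) (\<lambda>N. proj {..<N} (proj ?K c)) s sequentially"
    by (rule shift)
  finally show ?thesis by (simp add: limit_sections_iff)
qed

end

section \<open>Hypercyclicity for upper Furstenberg families by category\<close>

lemma continuous_map_funpow:
  assumes "continuous_map \<tau> \<tau> T" shows "continuous_map \<tau> \<tau> (T ^^ n)"
proof (induction n)
  case 0
  then show ?case using continuous_map_id by (simp add: id_def)
next
  case (Suc n)
  from continuous_map_compose[OF this assms] show ?case by (simp only: funpow.simps)
qed

lemma openin_finite_return_times:
  assumes "continuous_map \<tau> \<tau> T" "openin \<tau> V" "finite K"
  shows "openin \<tau> {x \<in> topspace \<tau>. \<forall>n\<in>K. (T ^^ n) x \<in> V}"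
  using assms(3)
proof induction
  case (insert n K)
  have "openin \<tau> {x \<in> topspace \<tau>. (T ^^ n) x \<in> V}"
    using continuous_map_funpow[OF assms(1)] assms(2) by (rule openin_continuous_map_preimage)
  from openin_Int[OF this insert.IH] show ?case
    by (rule back_subst[of "openin \<tau>"]) auto
qed simp

text \<open>
  Membership in a finitely hereditary upward family is witnessed by finitely many return times, and
  each of them persists on a neighbourhood by continuity.
\<close>

lemma openin_return_set_in_family:
  assumes T: "continuous_map \<tau> \<tau> T" and V: "openin \<tau> V" and B: "finitely_hereditary_upward \<B>"
  shows "openin \<tau> {x \<in> topspace \<tau>. {n. (T ^^ n) x \<in> V} \<in> \<B>}"
proof (subst openin_subopen, safe)
  fix x assume x: "x \<in> topspace \<tau>" "{n. (T ^^ n) x \<in> V} \<in> \<B>"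
  then obtain F where F: "finite F" "\<And>B. {n. (T ^^ n) x \<in> V} \<inter> F \<subseteq> B \<Longrightarrow> B \<in> \<B>"
    using B unfolding finitely_hereditary_upward_def by meson
  let ?W = "{y \<in> topspace \<tau>. \<forall>n\<in>{n. (T ^^ n) x \<in> V} \<inter> F. (T ^^ n) y \<in> V}"
  have "openin \<tau> ?W" using F(1) by (intro openin_finite_return_times[OF T V]) auto
  moreover have "x \<in> ?W" using x by auto
  moreover have "?W \<subseteq> {x \<in> topspace \<tau>. {n. (T ^^ n) x \<in> V} \<in> \<B>}"
    by (auto intro!: F(2))
  ultimately show "\<exists>W. openin \<tau> W \<and> x \<in> W \<and>
      W \<subseteq> {x \<in> topspace \<tau>. {n. (T ^^ n) x \<in> V} \<in> \<B>}" by blast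
qed

lemma finitely_hereditary_upward_mono:
  assumes "finitely_hereditary_upward \<B>" "A \<in> \<B>" "A \<subseteq> B" shows "B \<in> \<B>"
proof -
  obtain F where "\<And>B. A \<inter> F \<subseteq> B \<Longrightarrow> B \<in> \<B>"
    using assms(1,2) unfolding finitely_hereditary_upward_def by meson
  then show ?thesis using assms(3) by blast
qed

text \<open>
  For a fixed \<open>\<delta>\<close>, the points whose return set to \<open>V\<close> lies in \<open>\<Inter>\<mu>\<in>I. F \<delta> \<mu>\<close> form a countable
  intersection of open sets. It is dense if every open set contains such a point, which is why
  \<open>\<delta>\<close> has to be chosen depending on \<open>V\<close> but before \<open>U\<close>. Baire's theorem then provides one point
  that works for all \<open>V\<close> in the countable collection simultaneously.
\<close>

lemma (in Metric_space) family_hypercyclic_by_category: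
  assumes complete: "mcomplete" and nonempty: "M \<noteq> {}"
    and T: "continuous_map mtopology mtopology T"
    and upper: "upper_furstenberg_family \<A> D I F"
    and V: "countable \<V>" "\<And>V. V \<in> \<V> \<Longrightarrow> openin mtopology V"
      "\<And>U. openin mtopology U \<Longrightarrow> U \<noteq> {} \<Longrightarrow> \<exists>V\<in>\<V>. V \<subseteq> U"
    and local: "\<And>V. V \<in> \<V> \<Longrightarrow> \<exists>\<delta>\<in>D. \<forall>U. openin mtopology U \<and> U \<noteq> {} \<longrightarrow>
        (\<exists>x\<in>U. {n. (T ^^ n) x \<in> V} \<in> (\<Inter>\<mu>\<in>I. F \<delta> \<mu>))"
  shows "family_hypercyclic \<A> mtopology T"
proof -
  have F: "finitely_hereditary_upward (F \<delta> \<mu>)" if "\<delta> \<in> D" "\<mu> \<in> I" for \<delta> \<mu>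
    using upper that by (auto simp: upper_furstenberg_family_def)
  have A: "\<A> = (\<Union>\<delta>\<in>D. \<Inter>\<mu>\<in>I. F \<delta> \<mu>)" and I: "countable I"
    and up: "A \<in> \<A> \<Longrightarrow> A \<subseteq> B \<Longrightarrow> B \<in> \<A>" for A B
    using upper by (auto simp: upper_furstenberg_family_def furstenberg_family_def)
  obtain \<delta> where \<delta>: "\<And>V. V \<in> \<V> \<Longrightarrow> \<delta> V \<in> D"
    "\<And>V U. V \<in> \<V> \<Longrightarrow> openin mtopology U \<Longrightarrow> U \<noteq> {} \<Longrightarrow>
        \<exists>x\<in>U. {n. (T ^^ n) x \<in> V} \<in> (\<Inter>\<mu>\<in>I. F (\<delta> V) \<mu>)"
    using local by metis
  define G where "G V \<mu> = {x \<in> M. {n. (T ^^ n) x \<in> V} \<in> F (\<delta> V) \<mu>}" for V \<mu>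
  have "mtopology closure_of (\<Inter>((\<lambda>(V, \<mu>). G V \<mu>) ` (\<V> \<times> I))) = M"
  proof (rule metric_Baire_category[OF complete])
    show "countable ((\<lambda>(V, \<mu>). G V \<mu>) ` (\<V> \<times> I))" using V(1) I by simp
    fix S assume "S \<in> (\<lambda>(V, \<mu>). G V \<mu>) ` (\<V> \<times> I)"
    then obtain W \<mu> where S: "S = G W \<mu>" "W \<in> \<V>" "\<mu> \<in> I" by auto
    have "openin mtopology S"
      using openin_return_set_in_family[OF T V(2) F] S \<delta>(1) by (simp add: G_def)
    moreover have "\<exists>y\<in>S. y \<in> U" if U: "openin mtopology U" "x \<in> U" for x U
    proof -
      obtain y where "y \<in> U" "{n. (T ^^ n) y \<in> W} \<in> (\<Inter>\<mu>\<in>I. F (\<delta> W) \<mu>)"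
        using \<delta>(2)[OF S(2) U(1)] U(2) by blast
      moreover have "y \<in> M" using U(1) \<open>y \<in> U\<close> openin_subset by fastforce
      ultimately show ?thesis using S by (auto simp: G_def)
    qed
    then have "mtopology closure_of S = M"
      unfolding closure_of_def topspace_mtopology by blast
    ultimately show "openin mtopology S \<and> mtopology closure_of S = M" by blast
  qed
  then have "mtopology closure_of (M \<inter> \<Inter>((\<lambda>(V, \<mu>). G V \<mu>) ` (\<V> \<times> I))) = M"
    using closure_of_restrict[of mtopology] by (metis topspace_mtopology)
  then obtain x where x: "x \<in> M" "x \<in> \<Inter>((\<lambda>(V, \<mu>). G V \<mu>) ` (\<V> \<times> I))"
    using nonempty by (metis IntE closure_of_empty ex_in_conv)
  have "{n. (T ^^ n) x \<in> U} \<in> \<A>" if U: "openin mtopology U" "U \<noteq> {}" for U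
  proof -
    obtain W where W: "W \<in> \<V>" "W \<subseteq> U" using V(3)[OF U] by blast
    have "{n. (T ^^ n) x \<in> W} \<in> (\<Inter>\<mu>\<in>I. F (\<delta> W) \<mu>)"
      using x(2) W(1) by (auto simp: G_def)
    then have "{n. (T ^^ n) x \<in> W} \<in> \<A>" using A \<delta>(1)[OF W(1)] by blast
    then show ?thesis by (rule up) (use W(2) in auto)
  qed
  then show ?thesis using T x(1) by (auto simp: family_hypercyclic_def)
qed

lemma upper_family_facts:
  assumes "upper_furstenberg_family \<A> D M F"
  shows upper_family_eq: "\<A> = (\<Union>\<delta>\<in>D. \<Inter>\<mu>\<in>M. F \<delta> \<mu>)"
    and upper_family_upward: "A \<in> \<A> \<Longrightarrow> A \<subseteq> B \<Longrightarrow> B \<in> \<A>"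
    and upper_family_left_shift: "A \<in> \<A> \<Longrightarrow> \<exists>\<delta>\<in>D. \<forall>n. left_shift A n \<in> (\<Inter>\<mu>\<in>M. F \<delta> \<mu>)"
proof -
  note upper = assms[unfolded upper_furstenberg_family_def furstenberg_family_def]
  show "\<A> = (\<Union>\<delta>\<in>D. \<Inter>\<mu>\<in>M. F \<delta> \<mu>)" using upper by (elim conjE)
  show "A \<in> \<A> \<Longrightarrow> A \<subseteq> B \<Longrightarrow> B \<in> \<A>" using upper by meson
  show "A \<in> \<A> \<Longrightarrow> \<exists>\<delta>\<in>D. \<forall>n. left_shift A n \<in> (\<Inter>\<mu>\<in>M. F \<delta> \<mu>)" using upper by (elim conjE) (erule bspec)
qed

lemma ufi_facts:
  assumes "ufi_upper_furstenberg_family \<A> D M F"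
  shows ufi_upper: "upper_furstenberg_family \<A> D M F"
    and ufi_tails: "A \<in> \<A> \<Longrightarrow> \<exists>\<delta>\<in>D. \<forall>n. A - {0..n} \<in> (\<Inter>\<mu>\<in>M. F \<delta> \<mu>)"
  using assms by (simp_all add: ufi_upper_furstenberg_family_def)

lemma component_upward:
  assumes "upper_furstenberg_family \<A> D M F" "\<delta> \<in> D"
    and "A \<in> (\<Inter>\<mu>\<in>M. F \<delta> \<mu>)" "A \<subseteq> B"
  shows "B \<in> (\<Inter>\<mu>\<in>M. F \<delta> \<mu>)"
proof
  fix \<mu> assume "\<mu> \<in> M"
  then have "finitely_hereditary_upward (F \<delta> \<mu>)"
    using assms(1,2) by (auto simp: upper_furstenberg_family_def)
  then show "B \<in> F \<delta> \<mu>"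
    by (rule finitely_hereditary_upward_mono) (use assms(3,4) \<open>\<mu> \<in> M\<close> in auto)
qed

text \<open>
  The two uniformity properties are combined by applying finite invariance to the translated set,
  which is in the family by left-invariance. The single \<open>\<delta>\<close> obtained for all tails is what the
  category argument asks for: points taken from a smaller open set \<open>U\<close> only lose more return times
  at the beginning.
\<close>

lemma left_invariant_tails:
  assumes ufi: "ufi_upper_furstenberg_family \<A> D M F" and A: "A \<in> \<A>"
  shows "\<exists>\<delta>\<in>D. \<forall>n. left_shift A p - {0..n} \<in> (\<Inter>\<mu>\<in>M. F \<delta> \<mu>)"
proof (rule ufi_tails[OF ufi])
  show "left_shift A p \<in> \<A>"
    using upper_family_left_shift[OF ufi_upper[OF ufi] A]
    by (subst upper_family_eq[OF ufi_upper[OF ufi]]) blast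
qed

lemma ufi_tail_in:
  assumes ufi: "ufi_upper_furstenberg_family \<A> D M F" and A: "A \<in> \<A>"
  shows "A \<inter> {p..} \<in> \<A>"
proof (rule upper_family_upward[OF ufi_upper[OF ufi]])
  show "A - {0..p} \<in> \<A>"
    using ufi_tails[OF ufi A] by (subst upper_family_eq[OF ufi_upper[OF ufi]]) blast
qed auto

section \<open>Weighted shifts in coordinates\<close>

context F_seq_space
begin

lemma continuous_small:
  assumes "continuous_map (F_topology X nrm) (F_topology X nrm) f" "f 0 = 0" "0 < e"
  obtains r where "0 < r" "\<And>x. x \<in> X \<Longrightarrow> nrm x < r \<Longrightarrow> nrm (f x) < e"
proof -
  have "openin (F_topology X nrm) {x \<in> topspace (F_topology X nrm). f x \<in> {x\<in>X. nrm (x - 0) < e}}"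
    by (rule openin_continuous_map_preimage[OF assms(1) openin_ball[OF zero_in]])
  moreover have "0 \<in> {x \<in> X. f x \<in> {x\<in>X. nrm (x - 0) < e}}"
    using assms(2,3) zero_in nrm_zero by simp
  ultimately have "\<exists>r>0. \<forall>y\<in>X. nrm (y - 0) < r \<longrightarrow> y \<in> {x \<in> X. f x \<in> {x\<in>X. nrm (x - 0) < e}}"
    unfolding openin_iff topspace_F by blast
  then show ?thesis using that by auto
qed

text \<open>
  An F-norm need not be homogeneous, but it is subadditive, so a scalar is bounded through an integer
  that dominates its norm.
\<close>

lemma nrm_scale_bound: "\<exists>K. \<forall>x\<in>X. nrm (seq_scale c x) \<le> of_nat K * nrm x"
proof -
  obtain K :: nat where K: "norm c < of_nat K" using reals_Archimedean2 by blast
  then have K0: "K \<noteq> 0" by (auto intro: gr0I dest: order.strict_trans1[OF norm_ge_zero])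
  have "nrm (seq_scale c x) \<le> of_nat K * nrm x" if x: "x \<in> X" for x
  proof -
    have "seq_scale c x = seq_scale (c / of_nat K) (seq_scale (of_nat K) x)"
      using K0 by (simp add: pointwise)
    moreover have "norm (c / of_nat K) \<le> 1"
      using K K0 by (simp add: norm_divide)
    ultimately have "nrm (seq_scale c x) \<le> nrm (seq_scale (of_nat K) x)"
      using nrm_scale_le[OF scale_in[OF x]] by metis
    also have "\<dots> \<le> of_nat K * nrm x" by (rule nrm_of_nat_scale_le[OF x])
    finally show ?thesis .
  qed
  then show ?thesis by blast
qed

end

locale weighted_shift_space = F_seq_space_basis +
  fixes w :: "nat \<Rightarrow> 'a"
  assumes weight_nonzero: "n \<ge> 1 \<Longrightarrow> w n \<noteq> 0"
    and operator: "operator_on X nrm (weighted_backward_shift w)"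
begin

abbreviation T :: "(nat \<Rightarrow> 'a) \<Rightarrow> nat \<Rightarrow> 'a" where
  "T \<equiv> weighted_backward_shift w"

definition wprod :: "nat \<Rightarrow> 'a" where
  "wprod n = (\<Prod>\<nu>=1..n. w \<nu>)"

text \<open>
  The non-zero coordinates of the vectors \<open>f\<^sub>n = e\<^sub>n / (w\<^sub>1 \<cdots> w\<^sub>n)\<close>: the sequence \<open>proj A inv_wprod\<close> is the
  formal sum of the \<open>f\<^sub>n\<close> with \<open>n \<in> A\<close>.
\<close>

definition inv_wprod :: "nat \<Rightarrow> 'a" where
  "inv_wprod n = 1 / wprod n"

lemma wprod_nonzero [simp]: "wprod n \<noteq> 0"
  by (auto simp: wprod_def weight_nonzero)

lemma inv_wprod_nonzero [simp]: "inv_wprod n \<noteq> 0"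
  by (simp add: inv_wprod_def)

lemma wprod_Suc: "wprod (Suc n) = wprod n * w (Suc n)"
  by (simp add: wprod_def)

lemma T_funpow: "(T ^^ m) x k = wprod (k + m) / wprod k * x (k + m)"
proof (induction m arbitrary: k)
  case (Suc m)
  have "(T ^^ Suc m) x k = w (Suc k) * (T ^^ m) x (Suc k)"
    by (simp add: weighted_backward_shift_def)
  also have "\<dots> = wprod (k + Suc m) / wprod k * x (k + Suc m)"
    using weight_nonzero[of "Suc k"] by (simp add: Suc wprod_Suc[of k])
  finally show ?case .
qed simp

lemma T_funpow_add: "(T ^^ m) (x + y) = (T ^^ m) x + (T ^^ m) y"
  and T_funpow_zero: "(T ^^ m) 0 = 0"
  by (simp_all add: pointwise T_funpow distrib_left)

lemma T_continuous: "continuous_map (F_topology X nrm) (F_topology X nrm) T"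
  using operator by (simp add: operator_on_def)

lemma T_funpow_in: "x \<in> X \<Longrightarrow> (T ^^ m) x \<in> X"
  using continuous_map_funpow[OF T_continuous, of m] by (auto simp: continuous_map_def topspace_F Pi_iff)

lemma shift_condition_iff:
  "shift_condition X nrm w \<A> \<longleftrightarrow>
     (\<forall>p. \<forall>\<epsilon>>0. \<exists>A\<in>\<A>. A \<subseteq> {p..} \<and> proj A inv_wprod \<in> X \<and>
        (\<forall>m\<in>A. proj {k. k > p \<and> k + m - p \<in> A} inv_wprod \<in> X \<and>
               nrm (proj {k. k > p \<and> k + m - p \<in> A} inv_wprod) < \<epsilon>))"
proof -
  have u: "1 / (\<Prod>\<nu>=1..n. w \<nu>) = inv_wprod n" for n
    by (simp add: inv_wprod_def wprod_def)
  have "(\<exists>s. s \<in> X \<and> s = a) \<longleftrightarrow> a \<in> X" "(\<exists>s. (s \<in> X \<and> s = a) \<and> nrm s < e) \<longleftrightarrow> a \<in> X \<and> nrm a < e"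
    for a e by auto
  then show ?thesis
    unfolding shift_condition_def u series_sums_unit_iff series_sums_shifted_unit_iff by simp
qed

text \<open>
  For \<open>y\<close> supported on \<open>{0..p}\<close> this is the polynomial in \<open>T\<close> that sends \<open>f\<^sub>p\<close> to \<open>y\<close>: the number
  \<open>y j * wprod j\<close> is the coefficient of \<open>y\<close> at \<open>f\<^sub>j\<close>, and \<open>T ^^ (p - j)\<close> sends \<open>f\<^sub>p\<close> to \<open>f\<^sub>j\<close>. As a
  polynomial in \<open>T\<close> it is continuous and commutes with \<open>T\<close>, so it transports the behaviour of an
  orbit near \<open>f\<^sub>p\<close> to the arbitrary target \<open>y\<close>.
\<close>

definition shift_poly :: "nat \<Rightarrow> (nat \<Rightarrow> 'a) \<Rightarrow> (nat \<Rightarrow> 'a) \<Rightarrow> nat \<Rightarrow> 'a" where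
  "shift_poly p y x = (\<Sum>j\<le>p. seq_scale (y j * wprod j) ((T ^^ (p - j)) x))"

lemma shift_poly_in: "x \<in> X \<Longrightarrow> shift_poly p y x \<in> X"
  unfolding shift_poly_def by (intro sum_in scale_in T_funpow_in)

lemma shift_poly_add: "shift_poly p y (x + x') = shift_poly p y x + shift_poly p y x'"
  by (simp add: shift_poly_def T_funpow_add pointwise algebra_simps sum.distrib)

lemma shift_poly_small:
  assumes "0 < e"
  obtains r where "0 < r" "\<And>x. x \<in> X \<Longrightarrow> nrm x < r \<Longrightarrow> nrm (shift_poly p y x) < e"
proof -
  have "\<exists>r>0. \<forall>x\<in>X. nrm x < r \<longrightarrow>
      nrm (seq_scale (y j * wprod j) ((T ^^ (p - j)) x)) < e / Suc p" for j
  proof -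
    obtain K where K: "\<And>x. x \<in> X \<Longrightarrow> nrm (seq_scale (y j * wprod j) x) \<le> of_nat K * nrm x"
      using nrm_scale_bound by blast
    have "0 < e / Suc p / Suc K" using assms by simp
    from continuous_small[OF continuous_map_funpow[OF T_continuous] T_funpow_zero this]
    obtain r where r: "0 < r"
      "\<And>x. x \<in> X \<Longrightarrow> nrm x < r \<Longrightarrow> nrm ((T ^^ (p - j)) x) < e / Suc p / Suc K" by blast
    have "nrm (seq_scale (y j * wprod j) ((T ^^ (p - j)) x)) < e / Suc p"
      if x: "x \<in> X" "nrm x < r" for x
    proof -
      have "nrm (seq_scale (y j * wprod j) ((T ^^ (p - j)) x)) \<le> of_nat K * nrm ((T ^^ (p - j)) x)"
        by (intro K T_funpow_in x)
      also have "\<dots> \<le> of_nat (Suc K) * nrm ((T ^^ (p - j)) x)"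
        using nrm_nonneg[OF T_funpow_in[OF x(1)]] by (intro mult_right_mono) auto
      also have "\<dots> < of_nat (Suc K) * (e / Suc p / Suc K)"
        by (rule mult_strict_left_mono[OF r(2)[OF x]]) simp
      also have "\<dots> = e / Suc p" by (simp del: of_nat_Suc)
      finally show ?thesis .
    qed
    then show ?thesis using r(1) by blast
  qed
  then obtain r where r: "\<And>j. 0 < r j" "\<And>j x. x \<in> X \<Longrightarrow> nrm x < r j \<Longrightarrow>
      nrm (seq_scale (y j * wprod j) ((T ^^ (p - j)) x)) < e / Suc p"
    by metis
  have "nrm (shift_poly p y x) < e" if x: "x \<in> X" "nrm x < Min (r ` {..p})" for x
  proof -
    have "nrm (shift_poly p y x) \<le> (\<Sum>j\<le>p. nrm (seq_scale (y j * wprod j) ((T ^^ (p - j)) x)))"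
      unfolding shift_poly_def by (intro nrm_sum_le scale_in T_funpow_in x)
    also have "\<dots> < (\<Sum>j\<le>p. e / Suc p)"
      using x by (intro sum_strict_mono r(2)) auto
    also have "\<dots> = e" by (simp del: of_nat_Suc)
    finally show ?thesis .
  qed
  moreover have "0 < Min (r ` {..p})" using r(1) by simp
  ultimately show ?thesis using that by blast
qed

lemma T_funpow_shift_poly: "(T ^^ n) (shift_poly p y x) = shift_poly p y ((T ^^ n) x)"
proof -
  have "(T ^^ n) ((T ^^ m) x) = (T ^^ m) ((T ^^ n) x)" for m
    by (metis add.commute comp_apply funpow_add)
  then have eq: "(T ^^ m) ((T ^^ n) x) k = wprod (k + n) / wprod k * (T ^^ m) x (k + n)" for m k
    by (metis T_funpow)
  show ?thesis
    unfolding shift_poly_def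
    by (simp only: pointwise eq T_funpow[of n]) (simp add: sum_distrib_left mult_ac)
qed

lemma shift_poly_unit:
  assumes "\<And>k. p < k \<Longrightarrow> y k = 0"
  shows "shift_poly p y (proj {p} inv_wprod) = y"
proof
  fix k
  have "shift_poly p y (proj {p} inv_wprod) k
      = (\<Sum>j\<le>p. y j * wprod j * (wprod (k + (p - j)) / wprod k * (if k + (p - j) = p then inv_wprod (k + (p - j)) else 0)))"
    by (simp only: shift_poly_def pointwise T_funpow singleton_iff)
  also have "\<dots> = (\<Sum>j\<le>p. if k = j then y j else 0)"
    by (intro sum.cong refl) (auto simp: inv_wprod_def)
  also have "\<dots> = y k" using assms by auto
  finally show "shift_poly p y (proj {p} inv_wprod) k = y k" .
qed

end

section \<open>Sufficiency\<close>

lemma (in F_seq_space_basis) countable_dense_finite_sequences: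
  obtains Y where "countable Y" "\<And>y. y \<in> Y \<Longrightarrow> \<exists>p. \<forall>k>p. y k = 0" "Y \<subseteq> X"
    "\<And>z e. z \<in> X \<Longrightarrow> 0 < e \<Longrightarrow> \<exists>y\<in>Y. nrm (y - z) < e"
proof -
  obtain Q :: "'a set" where Q: "countable Q" "\<And>U. open U \<Longrightarrow> U \<noteq> {} \<Longrightarrow> \<exists>q\<in>Q. q \<in> U"
    using countable_dense_setE by blast
  define pad where "pad l = proj {..<length l} ((!) l)" for l :: "'a list"
  have "\<exists>y \<in> pad ` lists Q. nrm (y - z) < e" if z: "z \<in> X" and e: "0 < e" for z e
  proof -
    obtain N where N: "nrm (proj {..<N} z - z) < e/2"
      using section_near[OF z, of "e/2"] e by (metis half_gt_zero le_refl)
    have "\<forall>n. \<exists>q. q \<in> Q \<and> nrm (seq_scale (q - z n) (unit_seq n)) < e / 2 / Suc N"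
    proof
      fix n
      have "0 < e / 2 / Suc N" using e by simp
      from nrm_scale_small[OF unit_in this, of n] obtain r where
        r: "0 < r" "\<And>c. norm c < r \<Longrightarrow> nrm (seq_scale c (unit_seq n)) < e / 2 / Suc N" by blast
      have "ball (z n) r \<noteq> {}" using r(1) by simp
      then obtain q where "q \<in> Q" "q \<in> ball (z n) r" using Q(2) open_ball by blast
      moreover from this(2) have "norm (q - z n) < r"
        by (metis dist_norm dist_commute mem_ball)
      ultimately show "\<exists>q. q \<in> Q \<and> nrm (seq_scale (q - z n) (unit_seq n)) < e / 2 / Suc N"
        using r(2) by blast
    qed
    from choice[OF this] obtain q where q: "\<And>n. q n \<in> Q"
      "\<And>n. nrm (seq_scale (q n - z n) (unit_seq n)) < e / 2 / Suc N" by blast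
    have pad: "pad (map q [0..<N]) = proj {..<N} q" by (auto simp: pad_def pointwise)
    have "proj {..<N} q - proj {..<N} z = (\<Sum>n<N. seq_scale (q n - z n) (unit_seq n))"
      by (subst sum_unit_seq) (auto simp: pointwise)
    then have "nrm (proj {..<N} q - proj {..<N} z) = nrm (\<Sum>n<N. seq_scale (q n - z n) (unit_seq n))"
      by (rule arg_cong)
    also have "\<dots> \<le> (\<Sum>n<N. nrm (seq_scale (q n - z n) (unit_seq n)))"
      by (intro nrm_sum_le scale_in unit_in)
    also have "\<dots> \<le> (\<Sum>n<N. e / 2 / Suc N)" using q(2) by (intro sum_mono less_imp_le)
    also have "\<dots> = e / 2 * (real N / Suc N)" by simp
    also have "\<dots> \<le> e / 2" using e by (intro mult_left_le) auto
    finally have near: "nrm (proj {..<N} q - proj {..<N} z) \<le> e / 2" .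
    have "nrm (proj {..<N} q - z) \<le> nrm (proj {..<N} q - proj {..<N} z) + nrm (proj {..<N} z - z)"
      by (intro nrm_diff_triangle proj_finite_in z) auto
    then have "nrm (pad (map q [0..<N]) - z) < e" unfolding pad using near N by linarith
    moreover have "map q [0..<N] \<in> lists Q" using q(1) by auto
    ultimately show ?thesis by blast
  qed
  moreover have "countable (pad ` lists Q)" using Q(1) by simp
  moreover have "pad ` lists Q \<subseteq> X" by (auto simp: pad_def intro: proj_finite_in)
  moreover have "\<exists>p. \<forall>k>p. y k = 0" if y: "y \<in> pad ` lists Q" for y
  proof -
    obtain l where "y = pad l" using y by blast
    then have "\<forall>k>length l. y k = 0" by (simp add: pad_def proj_apply)
    then show ?thesis by blast
  qed
  ultimately show ?thesis using that by blast
qed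

context weighted_shift_space
begin

text \<open>
  Applying \<open>T ^^ (m - p)\<close> to the sum of the \<open>f\<^sub>n\<close> over \<open>n \<in> A\<close>, \<open>n \<ge> N\<close>, sends the term \<open>n = m\<close> to
  \<open>f\<^sub>p\<close> and the terms with \<open>n > m\<close> to the small remainder \<open>s m\<close>. The terms with \<open>n < m - p\<close> vanish,
  and there are none with \<open>m - p \<le> n < m\<close>, because two elements of \<open>A\<close> at a distance \<open>g \<le> p\<close> would
  give a remainder with the value \<open>inv_wprod (g + p)\<close> at \<open>g + p \<le> 2 * p\<close>, which the choice of \<open>\<epsilon>\<close>
  excludes. The shift polynomial then turns \<open>f\<^sub>p\<close> into \<open>y\<close>.
\<close>

lemma shift_poly_orbit:
  fixes A :: "nat set" and p :: nat and \<epsilon> :: real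
  defines "s \<equiv> \<lambda>m. proj {k. k > p \<and> k + m - p \<in> A} inv_wprod"
  assumes A: "A \<subseteq> {p..}"
    and s: "\<And>m. m \<in> A \<Longrightarrow> s m \<in> X \<and> nrm (s m) < \<epsilon>"
    and \<epsilon>: "\<And>k x. k \<le> 2 * p \<Longrightarrow> x \<in> X \<Longrightarrow> nrm x < \<epsilon> \<Longrightarrow> norm (x k) < norm (inv_wprod k)"
    and y: "\<And>k. p < k \<Longrightarrow> y k = 0"
    and m: "m \<in> A" "N \<le> m"
  shows "(T ^^ (m - p)) (shift_poly p y (proj (A \<inter> {N..}) inv_wprod)) = y + shift_poly p y (s m)"
proof -
  have gap: "n + p < m" if n: "n \<in> A" "n < m" for n
  proof (rule ccontr)
    assume "\<not> n + p < m"
    then have "m - n + p \<le> 2 * p" by simp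
    moreover have "s n (m - n + p) = inv_wprod (m - n + p)"
      using n m(1) by (simp add: s_def proj_apply)
    ultimately show False using \<epsilon>[of "m - n + p" "s n"] s[OF n(1)] by simp
  qed
  have "(T ^^ (m - p)) (proj (A \<inter> {N..}) inv_wprod) = proj {p} inv_wprod + s m"
  proof
    fix k
    have mp: "p \<le> m" using A m(1) by auto
    have low: "k + (m - p) \<notin> A" if "k < p"
    proof
      assume "k + (m - p) \<in> A"
      moreover have "k + (m - p) < m" using that mp by linarith
      ultimately show False using gap[of "k + (m - p)"] mp by linarith
    qed
    have "(T ^^ (m - p)) (proj (A \<inter> {N..}) inv_wprod) k
        = (if k + (m - p) \<in> A \<and> N \<le> k + (m - p) then inv_wprod k else 0)"
      by (simp add: T_funpow proj_apply inv_wprod_def)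
    also have "\<dots> = (proj {p} inv_wprod + s m) k"
      using mp m low by (cases k p rule: linorder_cases) (auto simp: pointwise s_def)
    finally show "(T ^^ (m - p)) (proj (A \<inter> {N..}) inv_wprod) k
        = (proj {p} inv_wprod + s m) k" .
  qed
  then show ?thesis
    by (simp only: T_funpow_shift_poly shift_poly_add shift_poly_unit[OF y])
qed

text \<open>
  Near a given point, take a finite section \<open>z\<close> and add the shift polynomial of a late tail of the
  sum of the \<open>f\<^sub>n\<close>, \<open>n \<in> A\<close>, which is small. Once \<open>z\<close> has been shifted away, the orbit is close to
  \<open>y\<close> at all times \<open>m - p\<close> with \<open>m \<in> A\<close>, that is, along \<open>left_shift A p\<close> up to a finite initial
  part.
\<close>

lemma shift_condition_local_return:
  assumes cond: "shift_condition X nrm w \<A>"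
    and ufi: "ufi_upper_furstenberg_family \<A> D M F"
    and y: "y \<in> X" "\<And>k. p < k \<Longrightarrow> y k = 0" and r: "0 < r"
  shows "\<exists>\<delta>\<in>D. \<forall>U. openin (F_topology X nrm) U \<and> U \<noteq> {} \<longrightarrow>
    (\<exists>x\<in>U. {n. (T ^^ n) x \<in> {x\<in>X. nrm (x - y) < r}} \<in> (\<Inter>\<mu>\<in>M. F \<delta> \<mu>))"
proof -
  let ?Q = "shift_poly p y"
  obtain \<rho> where \<rho>: "0 < \<rho>" "\<And>x. x \<in> X \<Longrightarrow> nrm x < \<rho> \<Longrightarrow> nrm (?Q x) < r"
    using shift_poly_small[OF r] by blast
  have "\<exists>\<rho>>0. \<forall>x\<in>X. nrm x < \<rho> \<longrightarrow> norm (x k) < norm (inv_wprod k)" for k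
    using coord_small[of "norm (inv_wprod k)" k] by (metis inv_wprod_nonzero zero_less_norm_iff)
  then obtain c where c: "\<And>k. 0 < c k"
    "\<And>k x. x \<in> X \<Longrightarrow> nrm x < c k \<Longrightarrow> norm (x k) < norm (inv_wprod k)" by metis
  \<comment> \<open>Below \<open>\<epsilon>\<close>, remainders are small after applying the polynomial and \<open>A\<close> has gaps larger than \<open>p\<close>.\<close>
  define \<epsilon> where "\<epsilon> = min \<rho> (Min (c ` {..2 * p}))"
  have \<epsilon>0: "0 < \<epsilon>" using \<rho>(1) c(1) by (simp add: \<epsilon>_def)
  have \<epsilon>: "norm (x k) < norm (inv_wprod k)" if "k \<le> 2 * p" "x \<in> X" "nrm x < \<epsilon>" for k x
    using that by (intro c(2)) (auto simp: \<epsilon>_def)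
  define s where "s A m = proj {k. k > p \<and> k + m - p \<in> A} inv_wprod" for A m
  obtain A where A: "A \<in> \<A>" "A \<subseteq> {p..}" and u: "proj A inv_wprod \<in> X"
    and s: "\<And>m. m \<in> A \<Longrightarrow> s A m \<in> X \<and> nrm (s A m) < \<epsilon>"
    using cond[unfolded shift_condition_iff, rule_format, OF \<epsilon>0, of p] unfolding s_def by blast
  obtain \<delta> where \<delta>: "\<delta> \<in> D" "\<And>n. left_shift A p - {0..n} \<in> (\<Inter>\<mu>\<in>M. F \<delta> \<mu>)"
    using left_invariant_tails[OF ufi A(1)] by blast
  have "\<exists>x\<in>U. {n. (T ^^ n) x \<in> {x\<in>X. nrm (x - y) < r}} \<in> (\<Inter>\<mu>\<in>M. F \<delta> \<mu>)"
    if U: "openin (F_topology X nrm) U" "U \<noteq> {}" for U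
  proof -
    obtain z0 where "z0 \<in> U" using U(2) by blast
    with U(1) obtain e where z0: "z0 \<in> X" and e: "0 < e" "\<And>x. x \<in> X \<Longrightarrow> nrm (x - z0) < e \<Longrightarrow> x \<in> U"
      unfolding openin_iff by blast
    obtain L where L: "nrm (proj {..<L} z0 - z0) < e/2"
      using section_near[OF z0, of "e/2"] e(1) by (metis half_gt_zero le_refl)
    obtain \<eta> where \<eta>: "0 < \<eta>" "\<And>x. x \<in> X \<Longrightarrow> nrm x < \<eta> \<Longrightarrow> nrm (?Q x) < e/2"
      using shift_poly_small[of "e/2" p y] e(1) by auto
    obtain N where N: "nrm (proj {..<N} (proj A inv_wprod) - proj A inv_wprod) < \<eta>"
      using section_near[OF u \<eta>(1)] by blast
    define z where "z = proj {..<L} z0"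
    define t where "t = proj (A \<inter> {N..}) inv_wprod"
    have z: "z \<in> X" by (simp add: z_def proj_finite_in)
    have t_eq: "t = proj A inv_wprod - proj {..<N} (proj A inv_wprod)"
      by (auto simp: t_def pointwise)
    then have t: "t \<in> X" using u by (auto intro: diff_in proj_finite_in)
    have "nrm t < \<eta>"
      unfolding t_eq using N by (subst nrm_diff_commute[OF u]) (auto intro: proj_finite_in)
    then have Qt: "nrm (?Q t) < e/2" using \<eta>(2)[OF t] by simp
    define x where "x = z + ?Q t"
    have x: "x \<in> X" unfolding x_def by (intro add_in z shift_poly_in t)
    have "x - z = ?Q t" by (simp add: x_def pointwise)
    then have "nrm (x - z0) \<le> nrm (?Q t) + nrm (z - z0)"
      using nrm_diff_triangle[OF x z z0] by metis
    then have "nrm (x - z0) < e" using L Qt unfolding z_def by linarith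
    then have "x \<in> U" using e(2) x by blast
    moreover have "left_shift A p - {0..L + N} \<subseteq> {n. (T ^^ n) x \<in> {x\<in>X. nrm (x - y) < r}}"
    proof
      fix n assume "n \<in> left_shift A p - {0..L + N}"
      then obtain m where m: "m \<in> A" "n = m - p" "L + N < n" by (auto simp: left_shift_def)
      have "(T ^^ n) z = 0" using m(3) by (simp add: z_def T_funpow pointwise)
      moreover have "(T ^^ n) (?Q t) = y + ?Q (s A m)"
        unfolding m(2) t_def s_def
        by (rule shift_poly_orbit[where \<epsilon> = \<epsilon>])
          (use s A(2) \<epsilon> y(2) m in \<open>simp_all add: s_def\<close>)
      ultimately have "(T ^^ n) x = y + ?Q (s A m)"
        by (simp only: x_def T_funpow_add add_0)
      then have "(T ^^ n) x - y = ?Q (s A m)" by (simp add: pointwise)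
      moreover have "nrm (?Q (s A m)) < r" using \<rho>(2) s[OF m(1)] by (simp add: \<epsilon>_def)
      ultimately show "n \<in> {n. (T ^^ n) x \<in> {x\<in>X. nrm (x - y) < r}}"
        using T_funpow_in[OF x] by simp
    qed
    ultimately show ?thesis
      using component_upward[OF ufi_upper[OF ufi] \<delta>(1) \<delta>(2)] by blast
  qed
  then show ?thesis using \<delta>(1) by blast
qed

text \<open>
  Balls of radius \<open>1 / Suc j\<close> around a countable dense set of finitely supported sequences serve as
  the countable collection of targets in the category argument.
\<close>

theorem shift_condition_imp_hypercyclic:
  assumes cond: "shift_condition X nrm w \<A>"
    and ufi: "ufi_upper_furstenberg_family \<A> D M F"
  shows "family_hypercyclic \<A> (F_topology X nrm) T"
proof -
  obtain Y where Y: "countable Y" "\<And>y. y \<in> Y \<Longrightarrow> \<exists>p. \<forall>k>p. y k = 0" "Y \<subseteq> X"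
    "\<And>z e. z \<in> X \<Longrightarrow> 0 < e \<Longrightarrow> \<exists>y\<in>Y. nrm (y - z) < e"
    using countable_dense_finite_sequences by blast
  define B where "B = (\<lambda>(y, j). {x\<in>X. nrm (x - y) < inverse (real (Suc j))})"
  show ?thesis
    unfolding F_topology_def
  proof (rule ms.family_hypercyclic_by_category[where \<V> = "B ` (Y \<times> UNIV)"])
    show "ms.mcomplete" using F_space by (simp add: F_sequence_space_def)
    show "X \<noteq> {}" using zero_in by blast
    show "continuous_map ms.mtopology ms.mtopology T"
      using T_continuous by (simp add: F_topology_def)
    show "upper_furstenberg_family \<A> D M F" by (rule ufi_upper[OF ufi])
    show "countable (B ` (Y \<times> UNIV))" using Y(1) by simp
    show "openin ms.mtopology V" if "V \<in> B ` (Y \<times> UNIV)" for V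
      using that openin_ball Y(3) by (auto simp: B_def F_topology_def)
    show "\<exists>V\<in>B ` (Y \<times> UNIV). V \<subseteq> U" if U: "openin ms.mtopology U" "U \<noteq> {}" for U
    proof -
      obtain z where "z \<in> U" using U(2) by blast
      moreover have "openin (F_topology X nrm) U" using U(1) by (simp add: F_topology_def)
      ultimately obtain e where z: "z \<in> X" and e: "0 < e" "\<And>x. x \<in> X \<Longrightarrow> nrm (x - z) < e \<Longrightarrow> x \<in> U"
        unfolding openin_iff by blast
      obtain j where j: "inverse (real (Suc j)) < e/2"
        using reals_Archimedean[of "e/2"] e(1) by auto
      obtain y where y: "y \<in> Y" "nrm (y - z) < e/2" using Y(4)[OF z, of "e/2"] e(1) by auto
      have "B (y, j) \<subseteq> U"
      proof
        fix x assume "x \<in> B (y, j)"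
        then have x: "x \<in> X" "nrm (x - y) < e/2" using j by (auto simp: B_def)
        have "nrm (x - z) \<le> nrm (x - y) + nrm (y - z)"
          using x y Y(3) z by (intro nrm_diff_triangle) auto
        then have "nrm (x - z) < e" using x(2) y(2) by linarith
        then show "x \<in> U" using e(2) x(1) by blast
      qed
      then show ?thesis using y(1) by blast
    qed
    show "\<exists>\<delta>\<in>D. \<forall>U. openin ms.mtopology U \<and> U \<noteq> {} \<longrightarrow>
        (\<exists>x\<in>U. {n. (T ^^ n) x \<in> V} \<in> (\<Inter>\<mu>\<in>M. F \<delta> \<mu>))" if "V \<in> B ` (Y \<times> UNIV)" for V
    proof -
      obtain y j where V: "V = {x\<in>X. nrm (x - y) < inverse (real (Suc j))}" "y \<in> Y"
        using \<open>V \<in> B ` (Y \<times> UNIV)\<close> by (auto simp: B_def)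
      obtain p where "\<And>k. p < k \<Longrightarrow> y k = 0" using Y(2)[OF V(2)] by blast
      moreover have "y \<in> X" using V(2) Y(3) by blast
      moreover have "0 < inverse (real (Suc j))" by simp
      ultimately show ?thesis
        using shift_condition_local_return[OF cond ufi, of y p "inverse (real (Suc j))"]
        unfolding V(1) F_topology_def by blast
    qed
  qed
qed

end

section \<open>Unconditional bases\<close>

lemma ex_bij_block:
  fixes a b :: nat
  assumes "G \<subseteq> {a..<b}"
  shows "\<exists>h. bij_betw h {a..<b} {a..<b} \<and> h ` {a..<a + card G} = G"
proof -
  have fin: "finite G" using assms finite_subset by blast
  have le: "card G \<le> b - a" using card_mono[OF _ assms] by simp
  obtain h1 where h1: "bij_betw h1 {a..<a + card G} G"
    using finite_same_card_bij[of "{a..<a + card G}" G] fin by auto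
  have "card {a + card G..<b} = card ({a..<b} - G)"
    using assms fin le by (simp add: card_Diff_subset)
  then obtain h2 where h2: "bij_betw h2 {a + card G..<b} ({a..<b} - G)"
    using finite_same_card_bij[of "{a + card G..<b}" "{a..<b} - G"] by auto
  define h where "h n = (if n < a + card G then h1 n else h2 n)" for n
  have 1: "bij_betw h {a..<a + card G} G"
    using h1 by (rule bij_betw_cong[THEN iffD1, rotated]) (simp add: h_def)
  have 2: "bij_betw h {a + card G..<b} ({a..<b} - G)"
    using h2 by (rule bij_betw_cong[THEN iffD1, rotated]) (simp add: h_def)
  have "bij_betw h ({a..<a + card G} \<union> {a + card G..<b}) (G \<union> ({a..<b} - G))"
    by (rule bij_betw_combine[OF 1 2]) auto
  moreover have "{a..<a + card G} \<union> {a + card G..<b} = {a..<b}"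
    using card_mono[OF _ assms] assms by (cases "G = {}") (auto simp: ivl_disj_un)
  moreover have "G \<union> ({a..<b} - G) = {a..<b}" using assms by auto
  ultimately show ?thesis using 1 by (auto simp: bij_betw_def)
qed

text \<open>
  Inside each block of indices, the set \<open>G k\<close> is enumerated first. Blocks of partial sums of the
  rearranged series then run exactly through the sets \<open>G k\<close>.
\<close>

lemma ex_bij_blocks:
  fixes a :: "nat \<Rightarrow> nat"
  assumes a: "strict_mono a" "a 0 = 0" and G: "\<And>k. G k \<subseteq> {a k..<a (Suc k)}"
  shows "\<exists>\<pi>. bij \<pi> \<and> (\<forall>k. \<pi> ` {a k..<a k + card (G k)} = G k)"
proof -
  define block where "block n = (LEAST k. n < a (Suc k))" for n
  have block: "block n = k" if "a k \<le> n" "n < a (Suc k)" for n k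
    unfolding block_def
  proof (rule Least_equality)
    fix j assume "n < a (Suc j)"
    then have "a k < a (Suc j)" using that by simp
    then show "k \<le> j" using strict_mono_less[OF a(1)] by simp
  qed (use that in simp)
  have in_block: "a (block n) \<le> n \<and> n < a (Suc (block n))" for n
  proof -
    have "n < a (Suc n)" using strict_mono_imp_increasing[OF a(1), of "Suc n"] by simp
    then have "n < a (Suc (block n))" unfolding block_def by (rule LeastI)
    moreover have "a (block n) \<le> n"
    proof (cases "block n")
      case (Suc j)
      then have "\<not> n < a (Suc j)" unfolding block_def by (intro not_less_Least) simp
      then show ?thesis using Suc by simp
    qed (simp add: a)
    ultimately show ?thesis by blast
  qed
  have "\<forall>k. \<exists>h. bij_betw h {a k..<a (Suc k)} {a k..<a (Suc k)} \<and>
      h ` {a k..<a k + card (G k)} = G k"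
    using ex_bij_block[OF G] by blast
  from choice[OF this] obtain h where
    h: "\<And>k. bij_betw (h k) {a k..<a (Suc k)} {a k..<a (Suc k)}"
       "\<And>k. h k ` {a k..<a k + card (G k)} = G k" by blast
  \<comment> \<open>The bijections of the blocks are glued together; \<open>\<pi>\<close> maps every block onto itself.\<close>
  define \<pi> where "\<pi> n = h (block n) n" for n
  have \<pi>_block: "block (\<pi> n) = block n" for n
  proof (rule block)
    have "h (block n) n \<in> {a (block n)..<a (Suc (block n))}"
      using bij_betwE[OF h(1)] in_block by auto
    then show "a (block n) \<le> \<pi> n" "\<pi> n < a (Suc (block n))" by (auto simp: \<pi>_def)
  qed
  have "inj \<pi>"
  proof (rule injI)
    fix m n assume eq: "\<pi> m = \<pi> n"
    then have "block m = block n" using \<pi>_block by metis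
    moreover from this have "h (block m) m = h (block m) n" using eq by (simp add: \<pi>_def)
    ultimately show "m = n"
      using bij_betw_imp_inj_on[OF h(1), of "block m"] in_block[of m] in_block[of n]
      by (auto dest: inj_onD)
  qed
  moreover have "\<exists>n. m = \<pi> n" for m
  proof -
    have "m \<in> h (block m) ` {a (block m)..<a (Suc (block m))}"
      using bij_betw_imp_surj_on[OF h(1), of "block m"] in_block[of m] by simp
    then obtain n where n: "a (block m) \<le> n" "n < a (Suc (block m))" "m = h (block m) n" by auto
    then have "m = \<pi> n" using block[OF n(1,2)] by (simp add: \<pi>_def)
    then show ?thesis by blast
  qed
  ultimately have "bij \<pi>" by (auto simp: bij_def surj_def)
  moreover have "\<pi> ` {a k..<a k + card (G k)} = G k" for k
  proof -
    have "card (G k) \<le> a (Suc k) - a k" using card_mono[OF _ G[of k]] by simp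
    then have "block n = k" if "n \<in> {a k..<a k + card (G k)}" for n
      using that strict_mono_less_eq[OF a(1), of k "Suc k"] by (intro block) auto
    then have "\<pi> ` {a k..<a k + card (G k)} = h k ` {a k..<a k + card (G k)}"
      by (intro image_cong) (auto simp: \<pi>_def)
    then show ?thesis using h(2) by simp
  qed
  ultimately show ?thesis by blast
qed

locale F_seq_space_unconditional = F_seq_space_basis +
  assumes unconditional: "unconditional_basis_of X nrm unit_seq"
begin

lemma rearranged_sections_converge:
  assumes "x \<in> X" "bij \<pi>"
  shows "limitin (F_topology X nrm) (\<lambda>N. proj (\<pi> ` {..<N}) x) x sequentially"
proof -
  have "series_sums X nrm UNIV (\<lambda>n. seq_scale (x n) (unit_seq n)) x"
    using assms(1) by (simp add: series_sums_unit_iff pointwise)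
  then have "series_sums X nrm UNIV (\<lambda>n. seq_scale (x (\<pi> n)) (unit_seq (\<pi> n))) x"
    using unconditional assms unfolding unconditional_basis_of_def by blast
  moreover have "(\<Sum>n<N. seq_scale (x (\<pi> n)) (unit_seq (\<pi> n))) = proj (\<pi> ` {..<N}) x" for N
  proof -
    have "inj_on \<pi> {..<N}" using bij_is_inj[OF assms(2)] inj_on_subset by blast
    from sum.reindex[OF this, of "\<lambda>n. seq_scale (x n) (unit_seq n)"] show ?thesis
      by (simp add: sum_unit_seq o_def)
  qed
  ultimately show ?thesis by (simp add: series_sums_def)
qed

text \<open>
  Otherwise there are finite sets \<open>G\<close> arbitrarily far out whose sections have F-norm at least \<open>e\<close>.
  Successive such sets can be placed in disjoint blocks, and a permutation that enumerates them
  contiguously makes the partial sums of the rearranged series violate the Cauchy criterion.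
\<close>

lemma finite_tails_small:
  assumes x: "x \<in> X" and e: "0 < e"
  obtains N where "\<And>G. finite G \<Longrightarrow> G \<subseteq> {N..} \<Longrightarrow> nrm (proj G x) < e"
proof -
  have "\<exists>N. \<forall>G. finite G \<and> G \<subseteq> {N..} \<longrightarrow> nrm (proj G x) < e"
  proof (rule ccontr)
    assume "\<not> ?thesis"
    then have "\<forall>N. \<exists>G. finite G \<and> G \<subseteq> {N..} \<and> e \<le> nrm (proj G x)"
      by (meson not_less)
    from choice[OF this] obtain G where
      G: "\<And>N. finite (G N)" "\<And>N. G N \<subseteq> {N..}" "\<And>N. e \<le> nrm (proj (G N) x)" by blast
    \<comment> \<open>The next block starts beyond the set found in the current one; \<open>a k\<close> is inserted so that the
      block is non-empty and the maximum is taken over a non-empty set.\<close>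
    define a where "a = rec_nat 0 (\<lambda>_ N. Suc (Max (insert N (G N))))"
    have a: "a 0 = 0" "\<And>k. a (Suc k) = Suc (Max (insert (a k) (G (a k))))"
      by (simp_all add: a_def)
    have bound: "n < a (Suc k)" if "n \<in> insert (a k) (G (a k))" for n k
      unfolding a(2) using that G(1) by (intro le_imp_less_Suc Max_ge) auto
    have mono: "strict_mono a" unfolding strict_mono_Suc_iff using bound by blast
    have "G (a k) \<subseteq> {a k..<a (Suc k)}" for k using G(2) bound by fastforce
    from ex_bij_blocks[of a "\<lambda>k. G (a k)", OF mono a(1) this] obtain \<pi> where
      \<pi>: "bij \<pi>" "\<And>k. \<pi> ` {a k..<a k + card (G (a k))} = G (a k)" by blast
    have "0 < e/2" using e by simp
    with rearranged_sections_converge[OF x \<pi>(1)] obtain M where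
      M: "\<And>n. n \<ge> M \<Longrightarrow> proj (\<pi> ` {..<n}) x \<in> X \<and> nrm (proj (\<pi> ` {..<n}) x - x) < e/2"
      unfolding limitin_iff by blast
    let ?n = "a M" and ?n' = "a M + card (G (a M))"
    have n: "M \<le> ?n" using strict_mono_imp_increasing[OF mono] .
    have "\<pi> ` {..<?n'} - \<pi> ` {..<?n} = \<pi> ` ({..<?n'} - {..<?n})"
      using bij_is_inj[OF \<pi>(1)] by (rule image_set_diff[symmetric])
    also have "{..<?n'} - {..<?n} = {?n..<?n'}" by auto
    finally have diff: "\<pi> ` {..<?n'} - \<pi> ` {..<?n} = G ?n" using \<pi>(2) by simp
    moreover have "\<pi> ` {..<?n} \<subseteq> \<pi> ` {..<?n'}" by (intro image_mono) auto
    ultimately have "proj (G ?n) x = proj (\<pi> ` {..<?n'}) x - proj (\<pi> ` {..<?n}) x"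
      by (auto simp: pointwise)
    moreover have "nrm (proj (\<pi> ` {..<?n'}) x - proj (\<pi> ` {..<?n}) x)
        \<le> nrm (proj (\<pi> ` {..<?n'}) x - x) + nrm (x - proj (\<pi> ` {..<?n}) x)"
      using M n x by (intro nrm_diff_triangle) auto
    moreover have "nrm (x - proj (\<pi> ` {..<?n}) x) = nrm (proj (\<pi> ` {..<?n}) x - x)"
      using M n x by (intro nrm_diff_commute) auto
    ultimately have "nrm (proj (G ?n) x) < e"
      using M[of ?n] M[of ?n'] n by fastforce
    then show False using G(3)[of ?n] by simp
  qed
  then show ?thesis using that by blast
qed

end

section \<open>Bounded multipliers\<close>

lemma (in F_seq_space_basis) proj_finite_small:
  assumes "finite G" "0 < e"
  shows "\<exists>r>0. \<forall>x\<in>X. nrm x < r \<longrightarrow> nrm (proj G x) < e"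
  using assms
proof (induction G arbitrary: e)
  case empty
  then show ?case by (auto simp: proj_def nrm_zero[unfolded zero_fun_def] intro!: exI[of _ 1])
next
  case (insert n G)
  obtain \<rho> where \<rho>: "0 < \<rho>" "\<And>c. norm c < \<rho> \<Longrightarrow> nrm (seq_scale c (unit_seq n)) < e/2"
    using nrm_scale_small[OF unit_in, of "e/2"] insert.prems by auto
  obtain r where r: "0 < r" "\<And>x. x \<in> X \<Longrightarrow> nrm x < r \<Longrightarrow> norm (x n) < \<rho>"
    using coord_small[OF \<rho>(1)] by blast
  obtain r' where r': "0 < r'" "\<And>x. x \<in> X \<Longrightarrow> nrm x < r' \<Longrightarrow> nrm (proj G x) < e/2"
    using insert.IH[of "e/2"] insert.prems by auto
  have "nrm (proj (insert n G) x) < e" if x: "x \<in> X" "nrm x < min r r'" for x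
  proof -
    have "proj (insert n G) x = seq_scale (x n) (unit_seq n) + proj G x"
      using insert.hyps by (auto simp: pointwise)
    then have "nrm (proj (insert n G) x) \<le> nrm (seq_scale (x n) (unit_seq n)) + nrm (proj G x)"
      using nrm_triangle[OF scale_in[OF unit_in] proj_finite_in[OF insert.hyps(1)]] by metis
    moreover have "nrm (seq_scale (x n) (unit_seq n)) < e/2" using x by (intro \<rho>(2) r(2)) auto
    moreover have "nrm (proj G x) < e/2" using x by (intro r'(2)) auto
    ultimately show ?thesis by linarith
  qed
  moreover have "0 < min r r'" using r(1) r'(1) by simp
  ultimately show ?case by blast
qed

context F_seq_space_unconditional
begin

text \<open>
  The section over \<open>G\<close> splits into one over a subset of \<open>{..<N}\<close>, for which there are only finitely
  many possibilities, and one in the tail, which is uniformly small.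
\<close>

lemma finite_sections_bounded:
  assumes x: "x \<in> X" and e: "0 < e"
  obtains k where "\<And>G. finite G \<Longrightarrow> nrm (seq_scale (inverse (of_nat (Suc k))) (proj G x)) < e"
proof -
  obtain N where N: "\<And>G. finite G \<Longrightarrow> G \<subseteq> {N..} \<Longrightarrow> nrm (proj G x) < e/2"
    using finite_tails_small[OF x, of "e/2"] e by auto
  have "\<exists>r>0. finite H \<longrightarrow> (\<forall>c. norm c < r \<longrightarrow> nrm (seq_scale c (proj H x)) < e/2)" for H
  proof (cases "finite H")
    case True
    have "0 < e/2" using e by simp
    from nrm_scale_small[OF proj_finite_in[OF True] this, of x] show ?thesis by blast
  qed (auto intro: exI[of _ 1])
  then have "\<forall>H. \<exists>r>0. finite H \<longrightarrow> (\<forall>c. norm c < r \<longrightarrow> nrm (seq_scale c (proj H x)) < e/2)"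
    by blast
  from choice[OF this] obtain r where r: "\<And>H. 0 < r H"
    "\<And>H c. finite H \<Longrightarrow> norm c < r H \<Longrightarrow> nrm (seq_scale c (proj H x)) < e/2" by blast
  have "0 < Min (r ` Pow {..<N})" using r(1) by (subst Min_gr_iff) auto
  then obtain k where k: "inverse (real (Suc k)) < Min (r ` Pow {..<N})"
    using reals_Archimedean by blast
  have "nrm (seq_scale (inverse (of_nat (Suc k))) (proj G x)) < e" if G: "finite G" for G
  proof -
    let ?c = "inverse (of_nat (Suc k)) :: 'a"
    have c: "norm ?c = inverse (real (Suc k))" by (simp only: norm_inverse norm_of_nat)
    then have "norm ?c \<le> 1" by (simp only: inverse_le_1_iff) simp
    let ?H = "G \<inter> {..<N}" and ?H' = "G \<inter> {N..}"
    have "nrm (seq_scale ?c (proj ?H x)) < e/2"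
    proof (rule r(2))
      have "r ?H \<in> r ` Pow {..<N}" by blast
      then have "Min (r ` Pow {..<N}) \<le> r ?H" by (intro Min_le) auto
      then show "norm ?c < r ?H" using k c by linarith
    qed (use G in simp)
    moreover have "nrm (seq_scale ?c (proj ?H' x)) \<le> nrm (proj ?H' x)"
      by (rule nrm_scale_le[OF proj_finite_in \<open>norm ?c \<le> 1\<close>]) (use G in simp)
    moreover have "nrm (proj ?H' x) < e/2" by (rule N) (use G in auto)
    moreover have "nrm (seq_scale ?c (proj ?H x) + seq_scale ?c (proj ?H' x))
        \<le> nrm (seq_scale ?c (proj ?H x)) + nrm (seq_scale ?c (proj ?H' x))"
      by (intro nrm_triangle scale_in proj_finite_in) (use G in auto)
    moreover have "seq_scale ?c (proj ?H x) + seq_scale ?c (proj ?H' x) = seq_scale ?c (proj G x)"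
      by (auto simp: pointwise)
    ultimately show ?thesis by fastforce
  qed
  then show ?thesis by (rule that)
qed

text \<open>
  The uniform boundedness principle for the projections onto finitely many coordinates. The sets
  \<open>E k\<close> of points at which all projections, scaled by \<open>1 / Suc k\<close>, are at most \<open>e/4\<close> are closed and
  cover \<open>X\<close>, so one of them contains a ball; taking differences moves the ball to the origin.
\<close>

lemma finite_sections_equicontinuous:
  assumes e: "0 < e"
  obtains r where "0 < r"
    "\<And>x G. x \<in> X \<Longrightarrow> nrm x < r \<Longrightarrow> finite G \<Longrightarrow> nrm (proj G x) < e"
proof -
  define c where "c k = (inverse (of_nat (Suc k)) :: 'a)" for k
  have c_le: "norm (c k) \<le> 1" for k
    unfolding c_def by (simp only: norm_inverse norm_of_nat inverse_le_1_iff) simp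
  define E where "E k = {x\<in>X. \<forall>G. finite G \<longrightarrow> nrm (seq_scale (c k) (proj G x)) \<le> e/4}" for k
  have closed: "closedin ms.mtopology (E k)" for k
  proof -
    have "openin (F_topology X nrm) (X - E k)"
      unfolding openin_iff
    proof (intro conjI ballI)
      fix x assume "x \<in> X - E k"
      then obtain G where x: "x \<in> X" and G: "finite G" "e/4 < nrm (seq_scale (c k) (proj G x))"
        by (auto simp: E_def not_le)
      obtain r where r: "0 < r" "\<And>z. z \<in> X \<Longrightarrow> nrm z < r \<Longrightarrow>
          nrm (proj G z) < nrm (seq_scale (c k) (proj G x)) - e/4"
        using proj_finite_small[OF G(1), of "nrm (seq_scale (c k) (proj G x)) - e/4"] G(2) by auto
      have "y \<in> X - E k" if y: "y \<in> X" "nrm (y - x) < r" for y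
      proof -
        have "nrm (seq_scale (c k) (proj G (y - x))) \<le> nrm (proj G (y - x))"
          by (intro nrm_scale_le proj_finite_in G c_le)
        moreover have "nrm (proj G (y - x)) < nrm (seq_scale (c k) (proj G x)) - e/4"
          using y x by (intro r(2) diff_in)
        moreover have "nrm (seq_scale (c k) (proj G y) - seq_scale (c k) (proj G (y - x)))
            \<le> nrm (seq_scale (c k) (proj G y)) + nrm (seq_scale (c k) (proj G (y - x)))"
          by (intro nrm_diff_le scale_in proj_finite_in G)
        moreover have "seq_scale (c k) (proj G y) - seq_scale (c k) (proj G (y - x))
            = seq_scale (c k) (proj G x)"
          by (auto simp: pointwise algebra_simps)
        ultimately have "e/4 < nrm (seq_scale (c k) (proj G y))" by fastforce
        then show ?thesis using y(1) G(1) by (auto simp: E_def not_le)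
      qed
      then show "\<exists>r>0. \<forall>y\<in>X. nrm (y - x) < r \<longrightarrow> y \<in> X - E k" using r(1) by blast
    qed auto
    moreover have "E k \<subseteq> X" by (auto simp: E_def)
    ultimately show ?thesis by (simp add: closedin_def F_topology_def)
  qed
  have "\<exists>k. ms.mtopology interior_of (E k) \<noteq> {}"
  proof (rule ccontr)
    assume "\<not> ?thesis"
    then have "ms.mtopology interior_of (\<Union>(range E)) = {}"
      using closed F_space by (intro ms.metric_Baire_category_alt) (auto simp: F_sequence_space_def)
    moreover have "\<Union>(range E) = X"
    proof
      show "X \<subseteq> \<Union>(range E)"
      proof
        fix x assume x: "x \<in> X"
        have "0 < e/4" using e by simp
        from finite_sections_bounded[OF x this] obtain k where
          "\<And>G. finite G \<Longrightarrow> nrm (seq_scale (c k) (proj G x)) < e/4" unfolding c_def by blast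
        then have "x \<in> E k" using x by (auto simp: E_def intro: less_imp_le)
        then show "x \<in> \<Union>(range E)" by blast
      qed
    qed (auto simp: E_def)
    ultimately show False
      using zero_in interior_of_topspace[of ms.mtopology] by auto
  qed
  then obtain k x0 where "x0 \<in> ms.mtopology interior_of (E k)" by blast
  then obtain U where U: "openin (F_topology X nrm) U" "x0 \<in> U" "U \<subseteq> E k"
    unfolding interior_of_def F_topology_def by blast
  then obtain r where r: "0 < r" "\<And>y. y \<in> X \<Longrightarrow> nrm (y - x0) < r \<Longrightarrow> y \<in> E k" and x0: "x0 \<in> X" "x0 \<in> E k"
    unfolding openin_iff by blast
  have "nrm (proj G x) < e" if x: "x \<in> X" "nrm x < r / Suc k" and G: "finite G" for x G
  proof -
    \<comment> \<open>The factor compensates the scaling in the definition of \<open>E k\<close>.\<close>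
    define z where "z = seq_scale (of_nat (Suc k)) x"
    have z: "z \<in> X" unfolding z_def by (rule scale_in[OF x(1)])
    have "nrm z \<le> of_nat (Suc k) * nrm x" unfolding z_def by (rule nrm_of_nat_scale_le[OF x(1)])
    also have "\<dots> < r" using x(2) by (simp add: pos_less_divide_eq mult.commute del: of_nat_Suc)
    finally have "nrm ((x0 + z) - x0) < r" by (simp only: add_diff_cancel_left')
    then have "x0 + z \<in> E k" using r(2) add_in[OF x0(1) z] by blast
    then have "nrm (seq_scale (c k) (proj G (x0 + z))) \<le> e/4" using G by (simp add: E_def)
    moreover have "nrm (seq_scale (c k) (proj G x0)) \<le> e/4" using x0(2) G by (simp add: E_def)
    moreover have "nrm (seq_scale (c k) (proj G (x0 + z)) - seq_scale (c k) (proj G x0))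
        \<le> nrm (seq_scale (c k) (proj G (x0 + z))) + nrm (seq_scale (c k) (proj G x0))"
      by (intro nrm_diff_le scale_in proj_finite_in G)
    moreover have "c k * of_nat (Suc k) = 1"
      unfolding c_def by (rule left_inverse) (simp only: of_nat_eq_0_iff)
    then have "seq_scale (c k) (proj G (x0 + z)) - seq_scale (c k) (proj G x0) = proj G x"
      by (simp only: pointwise z_def) (simp add: distrib_left mult.assoc[symmetric] del: of_nat_Suc)
    ultimately show ?thesis using e by fastforce
  qed
  moreover have "0 < r / Suc k" using r(1) by simp
  ultimately show ?thesis using that by blast
qed

end

text \<open>
  The multipliers form a point of the cube \<open>{0..1}\<close> to the power \<open>G\<close>, which is a convex combination
  of the vertices; a vertex is the indicator of a subset \<open>H\<close>. The offset \<open>y\<close> carries the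
  coordinates that have already been treated by the induction.
\<close>

lemma convex_multiplier:
  fixes C :: "(nat \<Rightarrow> 'k::{real_normed_field,euclidean_space}) set"
  assumes C: "seq_convex C" and "finite G" and t: "\<And>n. t n \<in> {0..1}"
    and "\<And>H. H \<subseteq> G \<Longrightarrow> y + proj H x \<in> C"
  shows "y + proj G (\<lambda>n. of_real (t n) * x n) \<in> C"
  using assms(2,4)
proof (induction G arbitrary: y)
  case (insert a G)
  let ?P = "proj G (\<lambda>n. of_real (t n) * x n)"
  have "y + ?P \<in> C" using insert.prems by (intro insert.IH) blast
  moreover have "y + proj {a} x + ?P \<in> C"
  proof (rule insert.IH)
    fix H assume "H \<subseteq> G"
    then have "y + proj {a} x + proj H x = y + proj (insert a H) x"
      using insert.hyps by (auto simp: pointwise)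
    moreover have "insert a H \<subseteq> insert a G" using \<open>H \<subseteq> G\<close> by blast
    ultimately show "y + proj {a} x + proj H x \<in> C" using insert.prems by metis
  qed
  ultimately have "seq_scale (of_real (1 - t a)) (y + ?P)
      + seq_scale (of_real (t a)) (y + proj {a} x + ?P) \<in> C"
    using C t[of a] unfolding seq_convex_def by blast
  moreover have "seq_scale (of_real (1 - t a)) (y + ?P)
      + seq_scale (of_real (t a)) (y + proj {a} x + ?P)
      = y + proj (insert a G) (\<lambda>n. of_real (t n) * x n)"
    using insert.hyps by (auto simp: pointwise algebra_simps)
  ultimately show ?case by metis
qed (use assms(4) in \<open>auto simp: proj_def\<close>)

locale Frechet_seq_space_unconditional = F_seq_space_unconditional +
  assumes Frechet: "Frechet_sequence_space X nrm"
begin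

lemma unit_interval_multiplier_small:
  assumes e: "0 < e"
  obtains \<eta> where "0 < \<eta>"
    "\<And>G x t. finite G \<Longrightarrow> (\<And>H. H \<subseteq> G \<Longrightarrow> nrm (proj H x) < \<eta>) \<Longrightarrow> (\<And>n. t n \<in> {0..1::real}) \<Longrightarrow>
       nrm (proj G (\<lambda>n. of_real (t n) * x n)) < e"
proof -
  have "openin (F_topology X nrm) {x\<in>X. nrm (x - 0) < e}" by (rule openin_ball[OF zero_in])
  moreover have "0 \<in> {x\<in>X. nrm (x - 0) < e}" using e zero_in nrm_zero by simp
  ultimately obtain C V where C: "seq_convex C" "C \<subseteq> {x\<in>X. nrm (x - 0) < e}"
    and V: "openin (F_topology X nrm) V" "0 \<in> V" "V \<subseteq> C"
    using Frechet unfolding Frechet_sequence_space_def by meson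
  obtain \<eta> where \<eta>: "0 < \<eta>" "\<And>x. x \<in> X \<Longrightarrow> nrm (x - 0) < \<eta> \<Longrightarrow> x \<in> V"
    using V(1,2) unfolding openin_iff by blast
  have "nrm (proj G (\<lambda>n. of_real (t n) * x n)) < e"
    if G: "finite G" and H: "\<And>H. H \<subseteq> G \<Longrightarrow> nrm (proj H x) < \<eta>" and t: "\<And>n. t n \<in> {0..1::real}" for G x t
  proof -
    have "0 + proj H x \<in> C" if "H \<subseteq> G" for H
    proof -
      have "proj H x \<in> X" using finite_subset[OF that G] by (rule proj_finite_in)
      then show ?thesis using \<eta>(2)[of "proj H x"] H[OF that] V(3) by auto
    qed
    then have "0 + proj G (\<lambda>n. of_real (t n) * x n) \<in> C"
      by (intro convex_multiplier C G t)
    then show ?thesis using C(2) by auto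
  qed
  then show ?thesis using \<eta>(1) that by blast
qed

text \<open>
  A scalar is expanded along the real basis of the field, and each real coefficient is split into
  its positive and negative part. This leaves \<open>2 * DIM('a)\<close> families of multipliers in
  \<open>{0..1}\<close>, each covered by local convexity.
\<close>

lemma finite_multiplier_small:
  assumes e: "0 < e"
  obtains \<eta> where "0 < \<eta>"
    "\<And>G x c. finite G \<Longrightarrow> (\<And>H. H \<subseteq> G \<Longrightarrow> nrm (proj H x) < \<eta>) \<Longrightarrow> (\<And>n. norm (c n) \<le> 1) \<Longrightarrow>
       nrm (proj G (\<lambda>n. c n * x n)) < e"
proof -
  define e' where "e' = e / (2 * DIM('a))"
  have e': "0 < e'" using e by (simp add: e'_def)
  obtain \<eta> where \<eta>: "0 < \<eta>"
    "\<And>G x t. finite G \<Longrightarrow> (\<And>H. H \<subseteq> G \<Longrightarrow> nrm (proj H x) < \<eta>) \<Longrightarrow> (\<And>n. t n \<in> {0..1::real}) \<Longrightarrow>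
       nrm (proj G (\<lambda>n. of_real (t n) * x n)) < e'"
    using unit_interval_multiplier_small[OF e'] by blast
  have "nrm (proj G (\<lambda>n. c n * x n)) < e"
    if G: "finite G" and H: "\<And>H. H \<subseteq> G \<Longrightarrow> nrm (proj H x) < \<eta>" and c: "\<And>n. norm (c n) \<le> 1" for G x c
  proof -
    define P where "P b = proj G (\<lambda>n. of_real (max 0 (c n \<bullet> b)) * x n)" for b
    define N where "N b = proj G (\<lambda>n. of_real (max 0 (- (c n \<bullet> b))) * x n)" for b
    have coeff: "\<bar>c n \<bullet> b\<bar> \<le> 1" if "b \<in> Basis" for n b
      using Basis_le_norm[OF that, of "c n"] c[of n] by linarith
    have P: "nrm (P b) < e'" if "b \<in> Basis" for b
      unfolding P_def using coeff[OF that] by (intro \<eta>(2) G H) (auto simp: abs_le_iff)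
    have N: "nrm (N b) < e'" if "b \<in> Basis" for b
      unfolding N_def using coeff[OF that] by (intro \<eta>(2) G H) (auto simp: abs_le_iff)
    have in_X: "P b \<in> X" "N b \<in> X" for b
      unfolding P_def N_def by (intro proj_finite_in G)+
    have "proj G (\<lambda>n. c n * x n) = (\<Sum>b\<in>Basis. seq_scale b (P b - N b))"
    proof
      fix n
      have "c n = (\<Sum>b\<in>Basis. (c n \<bullet> b) *\<^sub>R b)" by (simp add: euclidean_representation)
      also have "\<dots> = (\<Sum>b\<in>Basis. b * (of_real (max 0 (c n \<bullet> b)) - of_real (max 0 (- (c n \<bullet> b)))))"
        by (intro sum.cong refl) (auto simp: scaleR_conv_of_real max_def)
      finally have eq: "c n * x n = (\<Sum>b\<in>Basis. b * (of_real (max 0 (c n \<bullet> b)) - of_real (max 0 (- (c n \<bullet> b))))) * x n"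
        by simp
      have "(\<Sum>b\<in>Basis. seq_scale b (P b - N b)) n = (if n \<in> G then
          (\<Sum>b\<in>Basis. b * (of_real (max 0 (c n \<bullet> b)) - of_real (max 0 (- (c n \<bullet> b))))) * x n else 0)"
        by (simp add: pointwise P_def N_def sum_distrib_right left_diff_distrib right_diff_distrib mult.assoc)
      also have "\<dots> = proj G (\<lambda>n. c n * x n) n" by (simp only: proj_apply eq)
      finally show "proj G (\<lambda>n. c n * x n) n = (\<Sum>b\<in>Basis. seq_scale b (P b - N b)) n" ..
    qed
    then have "nrm (proj G (\<lambda>n. c n * x n)) = nrm (\<Sum>b\<in>Basis. seq_scale b (P b - N b))"
      by (rule arg_cong)
    also have "\<dots> \<le> (\<Sum>b\<in>Basis. nrm (seq_scale b (P b - N b)))"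
      by (intro nrm_sum_le scale_in diff_in in_X)
    also have "\<dots> < (\<Sum>b\<in>(Basis::'a set). 2 * e')"
    proof (rule sum_strict_mono)
      fix b :: 'a assume b: "b \<in> Basis"
      have "nrm (seq_scale b (P b - N b)) \<le> nrm (P b - N b)"
        using b by (intro nrm_scale_le diff_in in_X) simp
      also have "\<dots> \<le> nrm (P b) + nrm (N b)" by (intro nrm_diff_le in_X)
      finally show "nrm (seq_scale b (P b - N b)) < 2 * e'" using P[OF b] N[OF b] by linarith
    qed simp_all
    also have "\<dots> = e" by (simp add: e'_def)
    finally show ?thesis .
  qed
  then show ?thesis using \<eta>(1) that by blast
qed

text \<open>
  Smallness of the finite sections of \<open>x\<close> far out is inherited by the multiplied sequence, whose
  sections are therefore Cauchy.
\<close>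

lemma multiplier_in:
  assumes x: "x \<in> X" and c: "\<And>n. norm (c n) \<le> 1"
  shows "(\<lambda>n. c n * x n) \<in> X"
proof -
  let ?y = "\<lambda>n. c n * x n"
  have "\<exists>N. \<forall>n\<ge>N. nrm (proj {..<n} ?y - proj {..<N} ?y) < e" if e: "0 < e" for e
  proof -
    obtain \<eta> where \<eta>: "0 < \<eta>"
      "\<And>G x c. finite G \<Longrightarrow> (\<And>H. H \<subseteq> G \<Longrightarrow> nrm (proj H x) < \<eta>) \<Longrightarrow> (\<And>n. norm (c n) \<le> 1) \<Longrightarrow>
         nrm (proj G (\<lambda>n. c n * x n)) < e"
      using finite_multiplier_small[OF e] by blast
    obtain N where N: "\<And>G. finite G \<Longrightarrow> G \<subseteq> {N..} \<Longrightarrow> nrm (proj G x) < \<eta>"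
      using finite_tails_small[OF x \<eta>(1)] by blast
    have "nrm (proj {..<n} ?y - proj {..<N} ?y) < e" if "N \<le> n" for n
    proof -
      have "nrm (proj {N..<n} ?y) < e"
      proof (rule \<eta>(2)[OF _ _ c])
        fix H assume H: "H \<subseteq> {N..<n}"
        then have "finite H" using finite_subset by blast
        moreover have "H \<subseteq> {N..}" using H by auto
        ultimately show "nrm (proj H x) < \<eta>" by (rule N)
      qed simp
      moreover have "proj {..<n} ?y - proj {..<N} ?y = proj {N..<n} ?y"
        using that by (auto simp: pointwise)
      ultimately show ?thesis by (simp only:)
    qed
    then show ?thesis by blast
  qed
  then obtain s where "limitin (F_topology X nrm) (\<lambda>N. proj {..<N} ?y) s sequentially"
    using complete[of "\<lambda>N. proj {..<N} ?y"] proj_finite_in by blast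
  then show ?thesis by (metis limit_sections_iff)
qed

lemma multipliers_equicontinuous:
  assumes e: "0 < e"
  obtains r where "0 < r"
    "\<And>x c. x \<in> X \<Longrightarrow> nrm x < r \<Longrightarrow> (\<And>n. norm (c n) \<le> 1) \<Longrightarrow> nrm (\<lambda>n. c n * x n) \<le> e"
proof -
  obtain \<eta> where \<eta>: "0 < \<eta>"
    "\<And>G x c. finite G \<Longrightarrow> (\<And>H. H \<subseteq> G \<Longrightarrow> nrm (proj H x) < \<eta>) \<Longrightarrow> (\<And>n. norm (c n) \<le> 1) \<Longrightarrow>
       nrm (proj G (\<lambda>n. c n * x n)) < e"
    using finite_multiplier_small[OF e] by blast
  obtain r where r: "0 < r"
    "\<And>x G. x \<in> X \<Longrightarrow> nrm x < r \<Longrightarrow> finite G \<Longrightarrow> nrm (proj G x) < \<eta>"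
    using finite_sections_equicontinuous[OF \<eta>(1)] by blast
  have "nrm (\<lambda>n. c n * x n) \<le> e"
    if x: "x \<in> X" "nrm x < r" and c: "\<And>n. norm (c n) \<le> 1" for x c
  proof (rule nrm_limit_le[OF sections_converge[OF multiplier_in[OF x(1) c]]])
    fix N :: nat
    have "nrm (proj {..<N} (\<lambda>n. c n * x n)) < e"
    proof (rule \<eta>(2)[OF _ _ c])
      fix H :: "nat set" assume "H \<subseteq> {..<N}"
      then show "nrm (proj H x) < \<eta>" using r(2)[OF x] finite_subset by blast
    qed simp
    then show "nrm (proj {..<N} (\<lambda>n. c n * x n)) \<le> e" by simp
  qed
  then show ?thesis using r(1) that by blast
qed

end

section \<open>Necessity\<close>

locale unconditional_weighted_shift_space =
  weighted_shift_space + Frechet_seq_space_unconditional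
begin

text \<open>
  Let \<open>y\<close> be an \<open>\<A>\<close>-hypercyclic vector and \<open>b n\<close> its coefficient at \<open>f\<^sub>n\<close>. The set \<open>A\<close> collects the
  times \<open>m \<ge> p\<close> at which the orbit is close to \<open>f\<^sub>p\<close>; then \<open>b (m + p)\<close> is close to \<open>1\<close>. Both
  sequences in the shift condition arise from an orbit vector by keeping some coordinates and
  dividing them by numbers \<open>b (n + p)\<close> with \<open>n \<in> A\<close>, which is a bounded multiplier: for the first one
  the vector is \<open>(T ^^ p) y\<close>, and for the second one it is the small vector \<open>(T ^^ m) y - f\<^sub>p\<close>.
\<close>

theorem hypercyclic_imp_shift_condition:
  assumes ufi: "ufi_upper_furstenberg_family \<A> D M F"
    and hyp: "family_hypercyclic \<A> (F_topology X nrm) T"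
  shows "shift_condition X nrm w \<A>"
  unfolding shift_condition_iff
proof (intro allI impI)
  fix p :: nat and \<epsilon> :: real assume \<epsilon>: "0 < \<epsilon>"
  let ?f = "proj {p} inv_wprod"
  obtain y where y: "y \<in> X"
    "\<And>U. openin (F_topology X nrm) U \<Longrightarrow> U \<noteq> {} \<Longrightarrow> {n. (T ^^ n) y \<in> U} \<in> \<A>"
    using hyp unfolding family_hypercyclic_def topspace_F by blast
  obtain r1 where r1: "0 < r1" "\<And>x. x \<in> X \<Longrightarrow> nrm x < r1 \<Longrightarrow> norm (x p) < norm (inv_wprod p) / 2"
    using coord_small[of "norm (inv_wprod p) / 2" p] by auto
  obtain r2 where r2: "0 < r2"
    "\<And>x c. x \<in> X \<Longrightarrow> nrm x < r2 \<Longrightarrow> (\<And>n. norm (c n) \<le> 1) \<Longrightarrow> nrm (\<lambda>n. c n * x n) \<le> \<epsilon>/4"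
    using multipliers_equicontinuous[of "\<epsilon>/4"] \<epsilon> by auto
  define U where "U = {x\<in>X. nrm (x - ?f) < min r1 r2}"
  have f: "?f \<in> X" by (rule proj_finite_in) simp
  define A where "A = {n. (T ^^ n) y \<in> U} \<inter> {p..}"
  have "?f \<in> U" using f r1(1) r2(1) nrm_zero by (simp add: U_def)
  then have "{n. (T ^^ n) y \<in> U} \<in> \<A>"
    using y(2) openin_ball[OF f] unfolding U_def by blast
  then have "A \<in> \<A>" unfolding A_def by (rule ufi_tail_in[OF ufi])
  define b where "b n = wprod n * y n" for n
  have orbit: "(T ^^ m) y k = inv_wprod k * b (k + m)" for m k
    by (simp add: T_funpow b_def inv_wprod_def)
  define v where "v m = (T ^^ m) y - ?f" for m
  have v: "v m \<in> X" "nrm (v m) < r1" "nrm (v m) < r2" if "m \<in> A" for m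
    using that f T_funpow_in[OF y(1)] by (auto simp: v_def A_def U_def intro: diff_in)
  have b_large: "1 \<le> 2 * norm (b (m + p))" if m: "m \<in> A" for m
  proof -
    have "v m p = inv_wprod p * (b (m + p) - 1)"
      by (simp add: v_def pointwise orbit algebra_simps)
    then have "norm (inv_wprod p) * norm (b (m + p) - 1) < norm (inv_wprod p) * (1/2)"
      using r1(2)[OF v(1,2)[OF m]] by (simp add: norm_mult)
    moreover have "0 < norm (inv_wprod p)" by simp
    ultimately have "norm (b (m + p) - 1) < 1/2" by (metis mult_less_cancel_left_pos)
    moreover have "norm (1::'a) \<le> norm (b (m + p)) + norm (b (m + p) - 1)"
      using norm_triangle_sub[of 1 "b (m + p)"] by (simp add: norm_minus_commute)
    ultimately show ?thesis by simp
  qed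
  have b_nonzero: "b (m + p) \<noteq> 0" if "m \<in> A" for m
    using b_large[OF that] by auto
  have inv_b_le: "norm (1 / (2 * b (m + p))) \<le> 1" if "m \<in> A" for m
    using b_large[OF that] b_nonzero[OF that] by (simp add: norm_divide norm_mult divide_le_eq)
  have "proj A inv_wprod \<in> X"
  proof -
    \<comment> \<open>The factor 2 brings the multipliers into the unit ball.\<close>
    define c where "c n = (if n \<in> A then 1 / (2 * b (n + p)) else 0)" for n
    have "(\<lambda>n. c n * (T ^^ p) y n) \<in> X"
      by (rule multiplier_in[OF T_funpow_in[OF y(1)]]) (use inv_b_le in \<open>simp add: c_def\<close>)
    then have "seq_scale 2 (\<lambda>n. c n * (T ^^ p) y n) \<in> X" by (rule scale_in)
    moreover have "seq_scale 2 (\<lambda>n. c n * (T ^^ p) y n) = proj A inv_wprod"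
      using b_nonzero by (auto simp: pointwise c_def orbit)
    ultimately show ?thesis by (simp only:)
  qed
  moreover have "proj {k. k > p \<and> k + m - p \<in> A} inv_wprod \<in> X \<and>
      nrm (proj {k. k > p \<and> k + m - p \<in> A} inv_wprod) < \<epsilon>" if m: "m \<in> A" for m
  proof -
    let ?K = "{k. k > p \<and> k + m - p \<in> A}"
    define c where "c k = (if k \<in> ?K then 1 / (2 * b (k + m)) else 0)" for k
    have K: "k + m - p + p = k + m" "k + m - p \<in> A" if "k \<in> ?K" for k
      using that by auto
    have "norm (1 / (2 * b (k + m))) \<le> 1" if "k \<in> ?K" for k
      using inv_b_le[OF K(2)[OF that]] unfolding K(1)[OF that] .
    then have c: "norm (c k) \<le> 1" for k
      by (cases "k \<in> ?K") (simp_all only: c_def if_True if_False norm_zero zero_le_one)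
    have "b (k + m) \<noteq> 0" if "k \<in> ?K" for k
      using b_nonzero[OF K(2)[OF that]] unfolding K(1)[OF that] .
    then have eq: "seq_scale 2 (\<lambda>k. c k * v m k) = proj ?K inv_wprod"
      by (auto simp: pointwise c_def v_def orbit)
    have in_X: "(\<lambda>k. c k * v m k) \<in> X" by (rule multiplier_in[OF v(1)[OF m] c])
    have "nrm (seq_scale (of_nat 2) (\<lambda>k. c k * v m k)) \<le> of_nat 2 * nrm (\<lambda>k. c k * v m k)"
      by (rule nrm_of_nat_scale_le[OF in_X])
    also have "\<dots> \<le> of_nat 2 * (\<epsilon>/4)"
      using r2(2)[OF v(1,3)[OF m] c] by (intro mult_left_mono) auto
    also have "\<dots> < \<epsilon>" using \<epsilon> by simp
    finally have "nrm (proj ?K inv_wprod) < \<epsilon>" by (simp only: eq of_nat_numeral)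
    moreover have "proj ?K inv_wprod \<in> X" using scale_in[OF in_X, of 2] by (simp only: eq)
    ultimately show ?thesis by blast
  qed
  ultimately show "\<exists>A\<in>\<A>. A \<subseteq> {p..} \<and> proj A inv_wprod \<in> X \<and>
      (\<forall>m\<in>A. proj {k. k > p \<and> k + m - p \<in> A} inv_wprod \<in> X \<and>
             nrm (proj {k. k > p \<and> k + m - p \<in> A} inv_wprod) < \<epsilon>)"
    using \<open>A \<in> \<A>\<close> by (intro bexI[of _ A]) (auto simp: A_def)
qed

end

section \<open>The characterization\<close>

theorem theorem29:
  fixes X :: "(nat \<Rightarrow> 'k::{real_normed_field,euclidean_space}) set"
    and nrm :: "(nat \<Rightarrow> 'k) \<Rightarrow> real"
    and w :: "nat \<Rightarrow> 'k"
    and \<A> :: "nat set set"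
    and D :: "'d set" and M :: "'m set" and F :: "'d \<Rightarrow> 'm \<Rightarrow> nat set set"
  assumes "F_sequence_space X nrm"
    and "basis_of X nrm unit_seq"
    and "\<And>n. n \<ge> 1 \<Longrightarrow> w n \<noteq> 0"
    and "operator_on X nrm (weighted_backward_shift w)"
    and "ufi_upper_furstenberg_family \<A> D M F"
  shows "(shift_condition X nrm w \<A> \<longrightarrow>
            family_hypercyclic \<A> (F_topology X nrm) (weighted_backward_shift w)) \<and>
         (Frechet_sequence_space X nrm \<and> unconditional_basis_of X nrm unit_seq \<longrightarrow>
            family_hypercyclic \<A> (F_topology X nrm) (weighted_backward_shift w) \<longrightarrow>
            shift_condition X nrm w \<A>)"
proof -
  interpret weighted_shift_space X nrm w
    using assms(1-4) by unfold_locales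
  show ?thesis
  proof (intro conjI impI)
    assume "shift_condition X nrm w \<A>"
    then show "family_hypercyclic \<A> (F_topology X nrm) (weighted_backward_shift w)"
      using assms(5) by (rule shift_condition_imp_hypercyclic)
  next
    assume "Frechet_sequence_space X nrm \<and> unconditional_basis_of X nrm unit_seq"
    then interpret unconditional_weighted_shift_space X nrm w
      by unfold_locales auto
    assume "family_hypercyclic \<A> (F_topology X nrm) (weighted_backward_shift w)"
    with assms(5) show "shift_condition X nrm w \<A>" by (rule hypercyclic_imp_shift_condition)
  qed
qed

end
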